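(* Let $m,k\in\mathbb{N}$. Let $N(m,k)$ (resp. $\overline{N}(m,k)$) denote the minimal $n\in\mathbb{N}$ such that for every polygon $P$ with $m$ edges there exist real polynomials $p_1,\ldots,p_n$ satisfying conditions (A) and (C) (resp. ($\overline{A}$) and (C)), where (A) $\operatorname{int}P=\{x\in\mathbb{R}^2: p_1(x)>0,\ldots,p_n(x)>0\}$; ($\overline{A}$) $P=\{x\in\mathbb{R}^2: p_1(x)\ge 0,\ldots,p_n(x)\ge 0\}$; (C) every $p_i$ is a product of at most $k$ affine functions, each non-negative on $P$ and vanishing on some edge of $P$. Then, with $s(m,k):=\max\{m/k,\log_2 m\}$, $$s(m,k)\le N(m,k)\le\overline{N}(m,k)\le(1+\varepsilon_m)\,s(m,k),$$ where $\varepsilon_m\to 0$ as $m\to+\infty$.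
   Context: $\mathbb{N}$ is the set of positive integers. A polygon is a subset $P\subseteq\mathbb{R}^2$ that is the intersection of finitely many closed half-planes and has non-empty interior; it may be unbounded. Edges of $P$ are its one-dimensional faces. $\operatorname{int}P$ is the interior of $P$. The polynomials $p_1,\ldots,p_n$ are real polynomials in two variables, and affine functions are real polynomials in two variables of degree at most one.
   Formalization: The upper bound (1+ε_m)s(m,k) is stated only for m ≥ 2: for m = 1 one has N(1,k) = 1 and s(1,k) = 1/k, so no real ε_1 independent of k can satisfy it. *)

theory Defs
  imports "HOL-Analysis.Analysis"
begin

definition polygon :: "(real^2) set \<Rightarrow> bool" where
  "polygon P \<longleftrightarrow> polyhedron P \<and> interior P \<noteq> {}"

definition edges :: "(real^2) set \<Rightarrow> (real^2) set set" where
  "edges P = {e. e edge_of P}"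

text \<open>Polynomials in two variables are represented by their polynomial functions
  on \<open>real^2\<close>. A polynomial of degree at most one has the form below; the
  linear part \<open>a\<close> may be zero.\<close>

definition affine_function :: "(real^2 \<Rightarrow> real) \<Rightarrow> bool" where
  "affine_function f \<longleftrightarrow> (\<exists>a b. f = (\<lambda>x. a \<bullet> x + b))"

text \<open>The polynomials \<open>p\<^sub>1, \<dots>, p\<^sub>n\<close> are the values of a function \<open>p\<close> at the
  indices in \<open>{1..n}\<close>; its other values are irrelevant.\<close>

definition cond_A :: "(real^2) set \<Rightarrow> nat \<Rightarrow> (nat \<Rightarrow> real^2 \<Rightarrow> real) \<Rightarrow> bool" where
  "cond_A P n p \<longleftrightarrow> interior P = {x. \<forall>i\<in>{1..n}. p i x > 0}"

definition cond_Abar :: "(real^2) set \<Rightarrow> nat \<Rightarrow> (nat \<Rightarrow> real^2 \<Rightarrow> real) \<Rightarrow> bool" where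
  "cond_Abar P n p \<longleftrightarrow> P = {x. \<forall>i\<in>{1..n}. p i x \<ge> 0}"

definition cond_C :: "nat \<Rightarrow> (real^2) set \<Rightarrow> nat \<Rightarrow> (nat \<Rightarrow> real^2 \<Rightarrow> real) \<Rightarrow> bool" where
  "cond_C k P n p \<longleftrightarrow>
     (\<forall>i\<in>{1..n}. \<exists>r\<le>k. \<exists>f :: nat \<Rightarrow> real^2 \<Rightarrow> real.
        p i = (\<lambda>x. \<Prod>j=1..r. f j x) \<and>
        (\<forall>j\<in>{1..r}. affine_function (f j) \<and> (\<forall>x\<in>P. f j x \<ge> 0) \<and>
                     (\<exists>e\<in>edges P. \<forall>x\<in>e. f j x = 0)))"

text \<open>The minima below are over non-empty sets, since every polygon with \<open>m \<ge> 1\<close> edges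
  is described by \<open>m\<close> affine functions, one for each edge. The condition
  \<open>card (edges P) = m\<close> is only used for \<open>m \<ge> 1\<close>, so it includes finiteness of
  \<open>edges P\<close>.\<close>

definition N :: "nat \<Rightarrow> nat \<Rightarrow> nat" where
  "N m k = (LEAST n. n \<ge> 1 \<and>
     (\<forall>P. polygon P \<and> card (edges P) = m \<longrightarrow>
        (\<exists>p. (\<forall>i\<in>{1..n}. real_polynomial_function (p i)) \<and> cond_A P n p \<and> cond_C k P n p)))"

definition Nbar :: "nat \<Rightarrow> nat \<Rightarrow> nat" where
  "Nbar m k = (LEAST n. n \<ge> 1 \<and>
     (\<forall>P. polygon P \<and> card (edges P) = m \<longrightarrow>
        (\<exists>p. (\<forall>i\<in>{1..n}. real_polynomial_function (p i)) \<and> cond_Abar P n p \<and> cond_C k P n p)))"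

definition s :: "nat \<Rightarrow> nat \<Rightarrow> real" where
  "s m k = max (real m / real k) (log 2 (real m))"

end

theory Submission
  imports Defs "HOL-Real_Asymp.Real_Asymp"
begin

text \<open>
  Lower bounds. If an edge contributes to no polynomial, all of them are positive at a point of
  its relative interior, so \<open>m \<le> n k\<close>. For the polygon cut out by \<open>m\<close> tangents of a parabola, a
  point can violate exactly the tangents \<open>t, \<dots>, t' - 1\<close>; some polynomial must then contain an odd
  number of these, so the \<open>m + 1\<close> parity vectors of the numbers of tangents before \<open>t\<close> in each
  polynomial are distinct and \<open>m + 1 \<le> 2\<^sup>n\<close>.

  Upper bound. List the edges bounding \<open>P\<close> from below, then those bounding it from above, both
  by slope. If at most six edges each get a polynomial of their own, then
  a point outside \<open>P\<close> that satisfies these six inequalities violates an interval of the list,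
  and only its two neighbours may vanish there. So it suffices to colour the positions \<open>1, \<dots>, m\<close>
  such that every interval contains a colour occurring once in the interval enlarged by its
  neighbours, each colour being used at most \<open>k\<close> times. Joining
  words with this property by fresh separators in the pattern of the ruler sequence preserves
  it and costs the binary logarithm of the number of words. For small \<open>k\<close> join \<open>k\<close> words with
  about \<open>m/k\<close> distinct letters; for large \<open>k\<close> join ruler words of length about \<open>k/s\<close>
  and balance their letters by cyclic shifts. Both need at most \<open>s + 2 log\<^sub>2 s + O(1)\<close> colours.
\<close>

section \<open>Words with locally unique letters\<close>

text \<open>The letter at position \<open>j\<close> is the index of the polynomial that contains the \<open>j\<close>-th edge;
  \<open>{a..b}\<close> are the violated edges, and \<open>a - 1\<close>, \<open>b + 1\<close> those that may vanish.\<close>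

definition good :: "nat list \<Rightarrow> bool" where
  "good w \<longleftrightarrow> (\<forall>a b. a \<le> b \<and> b < length w \<longrightarrow>
     (\<exists>j\<in>{a..b}. \<forall>i<length w. w ! i = w ! j \<and> a \<le> i + 1 \<and> i \<le> b + 1 \<longrightarrow> i = j))"

lemma good_Nil: "good []"
  by (simp add: good_def)

lemma good_distinct: "distinct w \<Longrightarrow> good w"
  unfolding good_def by (auto simp: nth_eq_iff_index_eq intro!: bexI)

text \<open>Cutting off a tail only removes positions that could repeat the letter found for an
  interval.\<close>

lemma good_take:
  assumes "good w" shows "good (take n w)"
  unfolding good_def
proof (intro allI impI)
  fix a b assume "a \<le> b \<and> b < length (take n w)"
  then have *: "a \<le> b" "b < length w" "b < n" by auto
  then obtain j where j: "j \<in> {a..b}"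
    "\<forall>i<length w. w ! i = w ! j \<and> a \<le> i + 1 \<and> i \<le> b + 1 \<longrightarrow> i = j"
    using assms unfolding good_def by meson
  then show "\<exists>j\<in>{a..b}. \<forall>i<length (take n w).
      take n w ! i = take n w ! j \<and> a \<le> i + 1 \<and> i \<le> b + 1 \<longrightarrow> i = j"
    using * by (intro bexI[of _ j]) auto
qed

lemma good_map:
  assumes "good w" "inj_on f (set w)" shows "good (map f w)"
  unfolding good_def
proof (intro allI impI)
  fix a b assume *: "a \<le> b \<and> b < length (map f w)"
  then obtain j where j: "j \<in> {a..b}"
    "\<forall>i<length w. w ! i = w ! j \<and> a \<le> i + 1 \<and> i \<le> b + 1 \<longrightarrow> i = j"
    using assms(1) unfolding good_def by (metis length_map)
  have "f (w ! i) = f (w ! j) \<longleftrightarrow> w ! i = w ! j" if "i < length w" for i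
    using that j(1) * assms(2) by (auto simp: inj_on_eq_iff)
  then show "\<exists>j\<in>{a..b}. \<forall>i<length (map f w).
      map f w ! i = map f w ! j \<and> a \<le> i + 1 \<and> i \<le> b + 1 \<longrightarrow> i = j"
    using j * by (intro bexI[of _ j]) auto
qed

text \<open>An interval that meets the separator can use \<open>x\<close>, which occurs only once in
  the joined word. An interval inside \<open>u\<close> or \<open>v\<close> keeps its letter:
  enlarging it reaches at most the separator, which carries a different letter.\<close>

lemma good_join:
  assumes u: "good u" and v: "good v" and x: "x \<notin> set u" "x \<notin> set v"
  shows "good (u @ x # v)"
  unfolding good_def
proof (intro allI impI)
  let ?w = "u @ x # v" and ?l = "length u"
  fix a b assume *: "a \<le> b \<and> b < length ?w"
  have nthu: "?w ! i = u ! i" "u ! i \<noteq> x" if "i < ?l" for i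
    using that x(1) by (auto simp: nth_append in_set_conv_nth)
  have nthx: "?w ! ?l = x" by simp
  have nthv: "?w ! (Suc ?l + i) = v ! i" "v ! i \<noteq> x" if "i < length v" for i
    using that x(2) by (auto simp: nth_append in_set_conv_nth)
  have split: "i < ?l \<or> i = ?l \<or> (\<exists>i'. i = Suc ?l + i' \<and> i' < length v)" if "i < length ?w" for i
  proof -
    have "i < ?l \<or> i = ?l \<or> (i = Suc ?l + (i - Suc ?l) \<and> i - Suc ?l < length v)"
      using that by auto
    then show ?thesis by blast
  qed
  consider "b < ?l" | "a \<le> ?l" "?l \<le> b" | "?l < a" by linarith
  then show "\<exists>j\<in>{a..b}. \<forall>i<length ?w. ?w ! i = ?w ! j \<and> a \<le> i + 1 \<and> i \<le> b + 1 \<longrightarrow> i = j"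
  proof cases
    case 1
    then obtain j where j: "j \<in> {a..b}"
      "\<forall>i<length u. u ! i = u ! j \<and> a \<le> i + 1 \<and> i \<le> b + 1 \<longrightarrow> i = j"
      using u * unfolding good_def by meson
    show ?thesis
    proof (intro bexI[OF _ j(1)] allI impI)
      fix i assume i: "i < length ?w" "?w ! i = ?w ! j \<and> a \<le> i + 1 \<and> i \<le> b + 1"
      have jl: "j < ?l" using j(1) 1 by simp
      have "i \<le> ?l" using i(2) 1 by linarith
      moreover have "i \<noteq> ?l"
        using i(2) nthu[OF jl] nthx by metis
      ultimately have "i < ?l" by simp
      then show "i = j" using i(2) j(2) nthu[OF jl] nthu[of i] by metis
    qed
  next
    case 2
    show ?thesis
    proof (intro bexI[of _ ?l] allI impI)
      fix i assume i: "i < length ?w" "?w ! i = ?w ! ?l \<and> a \<le> i + 1 \<and> i \<le> b + 1"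
      then have "?w ! i = x" by simp
      then show "i = ?l" using split[OF i(1)] nthu nthv by metis
    qed (use 2 in auto)
  next
    case 3
    define a' b' where "a' = a - Suc ?l" and "b' = b - Suc ?l"
    have ab: "a = Suc ?l + a'" "b = Suc ?l + b'" "a' \<le> b'" "b' < length v"
      using 3 * by (auto simp: a'_def b'_def)
    then obtain j where j: "j \<in> {a'..b'}"
      "\<forall>i<length v. v ! i = v ! j \<and> a' \<le> i + 1 \<and> i \<le> b' + 1 \<longrightarrow> i = j"
      using v unfolding good_def by meson
    have jl: "j < length v" using j(1) ab by simp
    show ?thesis
    proof (intro bexI[of _ "Suc ?l + j"] allI impI)
      fix i assume i: "i < length ?w" "?w ! i = ?w ! (Suc ?l + j) \<and> a \<le> i + 1 \<and> i \<le> b + 1"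
      have "i \<noteq> ?l" using i(2) nthx nthv[OF jl] by metis
      moreover have "?l \<le> i" using i(2) ab by linarith
      ultimately obtain i' where i': "i = Suc ?l + i'" "i' < length v"
        using split[OF i(1)] by auto
      then have "v ! i' = v ! j" using i(2) nthv(1)[OF jl] nthv(1)[OF i'(2)] by metis
      then show "i = Suc ?l + j" using j(2) i' i(2) ab by auto
    qed (use j(1) ab in auto)
  qed
qed

text \<open>The blocks \<open>f 0\<close>, ..., \<open>f (2 ^ L - 1)\<close> interleaved with
  separators from \<open>c\<close>, ..., \<open>c + L - 1\<close>, whose levels form the ruler
  sequence. Both halves may reuse the same separators because the fresh letter \<open>c + L\<close>
  stands between them.\<close>

fun join :: "nat \<Rightarrow> nat \<Rightarrow> (nat \<Rightarrow> nat list) \<Rightarrow> nat list" where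
  "join c 0 f = f 0"
| "join c (Suc L) f = join c L f @ (c + L) # join c L (\<lambda>i. f (i + 2 ^ L))"

lemma set_join:
  assumes "\<And>i. set (f i) \<subseteq> {..<c}"
  shows "set (join c L f) \<subseteq> {..<c + L}"
  using assms
proof (induction L arbitrary: f)
  case (Suc L)
  have "set (join c L f) \<subseteq> {..<c + L}" "set (join c L (\<lambda>i. f (i + 2 ^ L))) \<subseteq> {..<c + L}"
    by (intro Suc.IH Suc.prems)+
  then show ?case by force
qed simp

lemma good_join_blocks:
  assumes "\<And>i. set (f i) \<subseteq> {..<c}" "\<And>i. good (f i)"
  shows "good (join c L f)"
  using assms
proof (induction L arbitrary: f)
  case (Suc L)
  have "set (join c L f) \<subseteq> {..<c + L}" "set (join c L (\<lambda>i. f (i + 2 ^ L))) \<subseteq> {..<c + L}"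
    by (intro set_join Suc.prems)+
  then show ?case
    unfolding join.simps by (intro good_join Suc.IH Suc.prems) auto
qed simp

lemma sum_lessThan_add: "(\<Sum>i<a + b. h i) = (\<Sum>i<a. h i) + (\<Sum>i<b. h (i + a))"
  for h :: "nat \<Rightarrow> nat"
  by (induction b) (auto simp: add_ac)

lemma sum_shift_pow2:
  "(\<Sum>i<2 ^ Suc L. h i) = (\<Sum>i<2 ^ L. h i) + (\<Sum>i<2 ^ L. h (i + 2 ^ L))"
  for h :: "nat \<Rightarrow> nat"
  using sum_lessThan_add[of h "2 ^ L" "2 ^ L"] by (simp add: mult_2)

lemma length_join: "length (join c L f) + 1 = (\<Sum>i<2 ^ L. length (f i)) + 2 ^ L"
proof (induction L arbitrary: f)
  case (Suc L)
  show ?case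
    using Suc[of f] Suc[of "\<lambda>i. f (i + 2 ^ L)"] sum_shift_pow2[of "\<lambda>i. length (f i)" L] by simp
qed simp

lemma count_join_block:
  assumes "x < c"
  shows "count_list (join c L f) x = (\<Sum>i<2 ^ L. count_list (f i) x)"
proof (induction L arbitrary: f)
  case (Suc L)
  show ?case
    using Suc[of f] Suc[of "\<lambda>i. f (i + 2 ^ L)"] sum_shift_pow2[of "\<lambda>i. count_list (f i) x" L] assms
    by simp
qed simp

text \<open>The top separator occurs once and each lower one twice as often as the next, so the most
  frequent one, \<open>c\<close>, occurs \<open>2 ^ (L - 1)\<close> times. Doubling the count also
  covers \<open>L = 0\<close>, where there is no separator.\<close>

lemma count_join_separator:
  assumes "\<And>i. set (f i) \<subseteq> {..<c}" "c \<le> x"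
  shows "2 * count_list (join c L f) x \<le> 2 ^ L"
  using assms
proof (induction L arbitrary: f)
  case 0
  have "x \<notin> set (f 0)" using 0 by fastforce
  then show ?case by simp
next
  case (Suc L)
  let ?f = "\<lambda>i. f (i + 2 ^ L)"
  have IH: "2 * count_list (join c L f) x \<le> 2 ^ L" "2 * count_list (join c L ?f) x \<le> 2 ^ L"
    by (intro Suc.IH Suc.prems)+
  show ?case
  proof (cases "x = c + L")
    case True
    have "set (join c L f) \<subseteq> {..<c + L}" "set (join c L ?f) \<subseteq> {..<c + L}"
      by (intro set_join Suc.prems)+
    then have "count_list (join c L f) x = 0" "count_list (join c L ?f) x = 0"
      unfolding count_list_0_iff using True by auto
    then show ?thesis using True by simp
  next
    case False
    then show ?thesis using IH by simp
  qed
qed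

text \<open>Empty blocks leave only the separators: 0, 1, 0, 2, 0, 1, 0, and so on.\<close>

definition ruler :: "nat \<Rightarrow> nat list" where
  "ruler d = join 0 d (\<lambda>_. [])"

lemma good_ruler: "good (ruler d)" and set_ruler: "set (ruler d) \<subseteq> {..<d}"
  and length_ruler: "length (ruler d) + 1 = 2 ^ d"
  using good_join_blocks[of "\<lambda>_. []" 0 d] set_join[of "\<lambda>_. []" 0 d] length_join[of 0 d "\<lambda>_. []"]
  by (auto simp: ruler_def good_Nil)

text \<open>Each position of \<open>w\<close> carries \<open>x\<close> under exactly one of the
  \<open>c\<close> shifts. Using all shifts equally often thus balances the letters of an unbalanced
  word.\<close>

lemma sum_count_rotations:
  fixes c x :: nat
  assumes "set w \<subseteq> {..<c}" "x < c"
  shows "(\<Sum>t<c. count_list (map (\<lambda>l. (t + l) mod c) w) x) = length w"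
  using assms(1)
proof (induction w)
  case (Cons l w)
  \<comment> \<open>The unique shift taking \<open>l\<close> to \<open>x\<close>; adding
    \<open>c\<close> keeps the natural subtraction exact.\<close>
  define t0 where "t0 = (x + c - l) mod c"
  have l: "l < c" using Cons.prems by simp
  have t: "(t + l) mod c = x \<longleftrightarrow> t = t0" if "t < c" for t
  proof
    assume "(t + l) mod c = x"
    then show "t = t0" using that l assms(2) unfolding t0_def
      by (auto simp: mod_if split: if_splits)
  next
    assume "t = t0"
    then show "(t + l) mod c = x" using that l assms(2) unfolding t0_def
      by (auto simp: mod_if split: if_splits)
  qed
  have "t0 < c" using l by (simp add: t0_def)
  have "(\<Sum>t<c. count_list (map (\<lambda>l. (t + l) mod c) (l # w)) x)
      = (\<Sum>t<c. (if t = t0 then 1 else 0) + count_list (map (\<lambda>l. (t + l) mod c) w) x)"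
    by (intro sum.cong) (auto simp: t)
  also have "\<dots> = 1 + length w"
    using Cons \<open>t0 < c\<close> by (simp add: sum.distrib)
  finally show ?case by simp
qed simp

section \<open>Irredundant systems of halfplanes\<close>

text \<open>Irredundancy is encoded by witnesses: \<open>q i\<close> lies on the \<open>i\<close>-th
  boundary line and strictly inside all other halfplanes, so it is a relative interior point of the
  \<open>i\<close>-th edge.\<close>

locale irredundant_halfplanes =
  fixes I :: "'i set" and a :: "'i \<Rightarrow> real^2" and b :: "'i \<Rightarrow> real" and q :: "'i \<Rightarrow> real^2"
  assumes finite_I: "finite I"
    and a_nonzero: "i \<in> I \<Longrightarrow> a i \<noteq> 0"
    and witness_zero: "i \<in> I \<Longrightarrow> a i \<bullet> q i + b i = 0"
    and witness_pos: "\<lbrakk>i \<in> I; j \<in> I; j \<noteq> i\<rbrakk> \<Longrightarrow> 0 < a j \<bullet> q i + b j"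
    and ex_inner: "\<exists>x. \<forall>i\<in>I. 0 < a i \<bullet> x + b i"
begin

definition g :: "'i \<Rightarrow> real^2 \<Rightarrow> real" where
  "g i x = a i \<bullet> x + b i"

definition P :: "(real^2) set" where
  "P = {x. \<forall>i\<in>I. 0 \<le> g i x}"

lemma g_witness: "i \<in> I \<Longrightarrow> g i (q i) = 0"
  by (simp add: g_def witness_zero)

lemma g_witness_pos: "\<lbrakk>i \<in> I; j \<in> I; j \<noteq> i\<rbrakk> \<Longrightarrow> 0 < g j (q i)"
  by (simp add: g_def witness_pos)

lemma witness_in_P: "i \<in> I \<Longrightarrow> q i \<in> P"
  unfolding P_def using g_witness g_witness_pos[of i]
  by (auto simp: le_less)

lemma P_nonneg: "\<lbrakk>i \<in> I; x \<in> P\<rbrakk> \<Longrightarrow> 0 \<le> g i x"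
  by (simp add: P_def)

lemma g_nonneg_iff: "0 \<le> g i x \<longleftrightarrow> - b i \<le> a i \<bullet> x"
  and g_pos_iff: "0 < g i x \<longleftrightarrow> - b i < a i \<bullet> x"
  by (auto simp: g_def)

lemma P_Inter: "P = (\<Inter>i\<in>I. {x. - b i \<le> a i \<bullet> x})"
  by (auto simp: P_def g_nonneg_iff)

lemma convex_P: "convex P"
  unfolding P_Inter by (intro convex_INT convex_halfspace_ge)

lemma open_g_pos: "open {x. \<forall>i\<in>I. 0 < g i x}"
proof -
  have "{x. \<forall>i\<in>I. 0 < g i x} = (\<Inter>i\<in>I. {x. - b i < a i \<bullet> x})"
    by (auto simp: g_pos_iff)
  then show ?thesis using finite_I by (simp add: open_INT open_halfspace_gt)
qed

text \<open>Near \<open>q i\<close> only the \<open>i\<close>-th inequality matters: the other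
  functions stay positive by continuity, while the \<open>i\<close>-th is affine and vanishes at
  \<open>q i\<close>.\<close>

lemma move_off_witness:
  assumes i: "i \<in> I"
  obtains t :: real where "0 < t" "\<And>j. j \<in> I \<Longrightarrow> j \<noteq> i \<Longrightarrow> 0 < g j (q i + t *\<^sub>R v)"
    "g i (q i + t *\<^sub>R v) = t * (a i \<bullet> v)"
proof -
  let ?x = "\<lambda>t. q i + t *\<^sub>R v"
  have ev: "eventually (\<lambda>t. 0 < g j (?x t)) (at_right 0)" if "j \<in> I - {i}" for j
  proof -
    have "((\<lambda>t. g j (?x t)) \<longlongrightarrow> g j (?x 0)) (at_right 0)"
      unfolding g_def by (intro tendsto_intros)
    then show ?thesis
      by (rule order_tendstoD(1)) (use g_witness_pos i that in simp)
  qed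
  then have "eventually (\<lambda>t. \<forall>j\<in>I-{i}. 0 < g j (?x t)) (at_right 0)"
    using finite_I by (intro eventually_ball_finite) auto
  moreover have "eventually (\<lambda>t::real. 0 < t) (at_right 0)"
    by (simp add: eventually_at_right_less)
  ultimately have "eventually (\<lambda>t. (\<forall>j\<in>I-{i}. 0 < g j (?x t)) \<and> 0 < t) (at_right 0)"
    by eventually_elim simp
  then obtain t :: real where t: "\<forall>j\<in>I-{i}. 0 < g j (?x t)" "0 < t"
    using eventually_happens'[OF trivial_limit_at_right_real] by blast
  moreover have "g i (?x t) = t * (a i \<bullet> v)"
    using g_witness[OF i] by (simp add: g_def inner_add_right)
  ultimately show ?thesis using that by blast
qed

lemma interior_P: "interior P = {x. \<forall>i\<in>I. 0 < g i x}"
proof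
  show "{x. \<forall>i\<in>I. 0 < g i x} \<subseteq> interior P"
    by (intro interior_maximal open_g_pos) (auto simp: P_def less_imp_le)
  show "interior P \<subseteq> {x. \<forall>i\<in>I. 0 < g i x}"
  proof clarify
    fix x i assume *: "x \<in> interior P" "i \<in> I"
    have "P \<subseteq> {x. - b i \<le> a i \<bullet> x}" using * P_Inter by blast
    then have "x \<in> interior {x. - b i \<le> a i \<bullet> x}" using * interior_mono by blast
    then show "0 < g i x" using a_nonzero[OF *(2)] by (simp add: interior_halfspace_ge g_def)
  qed
qed

lemma interior_P_nonempty: "interior P \<noteq> {}"
  using ex_inner by (auto simp: interior_P g_def)

lemma polygon_P: "polygon P"
proof -
  have "polyhedron P"
    unfolding P_Inter using finite_I
    by (intro polyhedron_Inter) (auto simp: polyhedron_halfspace_ge)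
  then show ?thesis by (simp add: polygon_def interior_P_nonempty)
qed

section \<open>Edges and supporting affine functions\<close>

definition edge :: "'i \<Rightarrow> (real^2) set" where
  "edge i = {x \<in> P. g i x = 0}"

lemma witness_in_edge: "i \<in> I \<Longrightarrow> q i \<in> edge i"
  by (simp add: edge_def g_witness witness_in_P)

lemma inj_edge: "inj_on edge I"
proof (rule inj_onI)
  fix i j assume *: "i \<in> I" "j \<in> I" "edge i = edge j"
  then have "g j (q i) = 0" using witness_in_edge[of i] by (simp add: edge_def)
  then show "i = j" using g_witness_pos[of i j] * by force
qed

lemma edges_P: "edges P = edge ` I"
proof -
  define H where "H i = {x. (- a i) \<bullet> x \<le> b i}" for i
  have H: "x \<in> H i \<longleftrightarrow> 0 \<le> g i x" for x i by (auto simp: H_def g_def)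
  have injH: "inj_on H I"
  proof (rule inj_onI)
    fix i j assume *: "i \<in> I" "j \<in> I" "H i = H j"
    show "i = j"
    proof (rule ccontr)
      assume "i \<noteq> j"
      obtain t :: real where t: "0 < t"
          "\<And>j. j \<in> I \<Longrightarrow> j \<noteq> i \<Longrightarrow> 0 < g j (q i + t *\<^sub>R (- a i))"
          "g i (q i + t *\<^sub>R (- a i)) = t * (a i \<bullet> (- a i))"
        using move_off_witness[OF *(1)] by blast
      let ?x = "q i + t *\<^sub>R (- a i)"
      have "g i ?x < 0" using t(1,3) a_nonzero[OF *(1)] by simp
      moreover have "0 < g j ?x" using t(2)[of j] * \<open>i \<noteq> j\<close> by blast
      ultimately show False using H[of ?x i] H[of ?x j] *(3) by simp
    qed
  qed
  \<comment> \<open>\<open>facet_of_polyhedron_explicit\<close> indexes normals by halfplanes, so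
    the index is recovered from the halfplane.\<close>
  define G where "G = the_inv_into I H"
  have G: "G (H i) = i" if "i \<in> I" for i
    unfolding G_def using injH that by (rule the_inv_into_f_f)
  have aff: "affine hull P = UNIV"
    using interior_P_nonempty affine_hull_nonempty_interior by blast
  have "C facet_of P \<longleftrightarrow> (\<exists>h. h \<in> H ` I \<and> C = P \<inter> {x. (- a (G h)) \<bullet> x = b (G h)})" for C
  proof (rule facet_of_polyhedron_explicit)
    show "finite (H ` I)" using finite_I by simp
    show "P = affine hull P \<inter> \<Inter> (H ` I)"
      by (simp add: aff) (auto simp: P_def H)
    show "- a (G h) \<noteq> 0 \<and> h = {x. - a (G h) \<bullet> x \<le> b (G h)}" if "h \<in> H ` I" for h
      using that G a_nonzero H_def by auto
    show "P \<subset> affine hull P \<inter> \<Inter> F'" if F': "F' \<subset> H ` I" for F'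
    proof -
      obtain i where i: "i \<in> I" "H i \<notin> F'" using F' by blast
      obtain t :: real where t: "0 < t"
          "\<And>j. j \<in> I \<Longrightarrow> j \<noteq> i \<Longrightarrow> 0 < g j (q i + t *\<^sub>R (- a i))"
          "g i (q i + t *\<^sub>R (- a i)) = t * (a i \<bullet> (- a i))"
        using move_off_witness[OF i(1)] by blast
      let ?x = "q i + t *\<^sub>R (- a i)"
      have "g i ?x < 0" using t(1,3) a_nonzero[OF i(1)] by simp
      then have "?x \<notin> P" using i(1) P_nonneg by fastforce
      moreover have "?x \<in> \<Inter> F'"
      proof clarify
        fix h assume "h \<in> F'"
        then obtain j where j: "j \<in> I" "h = H j" "j \<noteq> i" using F' i by auto
        then have "0 < g j ?x" using t(2) by blast
        then show "?x \<in> h" using j(2) H by simp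
      qed
      moreover have "P \<subseteq> \<Inter> F'" using F' H by (fastforce simp: P_def)
      ultimately show ?thesis by (auto simp: aff)
    qed
  qed
  moreover have "P \<inter> {x. - a i \<bullet> x = b i} = edge i" for i
    by (auto simp: edge_def g_def algebra_simps)
  ultimately have "C facet_of P \<longleftrightarrow> C \<in> edge ` I" for C
    using G by auto
  moreover have "aff_dim P = 2"
    using aff_dim_affine_hull[of P] by (simp add: aff)
  then have "C \<in> edges P \<longleftrightarrow> C facet_of P" for C
    by (auto simp: edges_def edge_of_def facet_of_def)
  ultimately show ?thesis by blast
qed

lemma card_edges_P: "card (edges P) = card I"
  by (simp add: edges_P card_image inj_edge)

text \<open>Near \<open>q i\<close> the polygon looks like a halfplane, and an affine function that
  vanishes at \<open>q i\<close> and is non-negative there is a multiple of \<open>g i\<close>. The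
  case \<open>c = 0\<close> is the zero function, which condition (C) admits as a factor.\<close>

lemma supporting_affine:
  assumes f: "affine_function f" and nonneg: "\<And>x. x \<in> P \<Longrightarrow> 0 \<le> f x"
    and e: "e \<in> edges P" "\<And>x. x \<in> e \<Longrightarrow> f x = 0"
  obtains c i where "i \<in> I" "0 \<le> c" "f = (\<lambda>x. c * g i x)"
proof -
  obtain a' b' where f_eq: "f = (\<lambda>x. a' \<bullet> x + b')"
    using f unfolding affine_function_def by blast
  obtain i where i: "i \<in> I" "e = edge i" using e(1) edges_P by blast
  have fq: "f (q i) = 0" using e(2) i witness_in_edge by blast
  have key: "0 \<le> a' \<bullet> v" if v: "0 \<le> a i \<bullet> v" for v
  proof -
    obtain t :: real where t: "0 < t"
        "\<And>j. j \<in> I \<Longrightarrow> j \<noteq> i \<Longrightarrow> 0 < g j (q i + t *\<^sub>R v)"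
        "g i (q i + t *\<^sub>R v) = t * (a i \<bullet> v)"
      using move_off_witness[OF i(1)] by blast
    let ?x = "q i + t *\<^sub>R v"
    have "0 \<le> g j ?x" if "j \<in> I" for j
      using that t v by (cases "j = i") (auto simp: less_imp_le)
    then have "?x \<in> P" by (simp add: P_def)
    then have "0 \<le> f ?x" by (rule nonneg)
    also have "f ?x = f (q i) + t * (a' \<bullet> v)" by (simp add: f_eq inner_add_right)
    finally show ?thesis using fq t(1) by (simp add: zero_le_mult_iff)
  qed
  \<comment> \<open>\<open>c\<close> is the coefficient of the projection of \<open>a'\<close> onto
    \<open>a i\<close>, and \<open>v\<close> is the remainder. Both \<open>v\<close> and
    \<open>- v\<close> satisfy the premise of \<open>key\<close>, which forces
    \<open>v = 0\<close>.\<close>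
  define c where "c = a' \<bullet> a i / (a i \<bullet> a i)"
  have ai: "0 < a i \<bullet> a i" using a_nonzero[OF i(1)] by simp
  define v where "v = a' - c *\<^sub>R a i"
  have av: "a i \<bullet> v = 0"
    using ai by (simp add: v_def c_def inner_diff_right inner_commute)
  have "0 \<le> a' \<bullet> v" "0 \<le> a' \<bullet> (- v)" using av by (intro key; simp)+
  then have "a' \<bullet> v = 0" by simp
  then have "v \<bullet> v = 0" using av by (simp add: v_def inner_diff_left)
  then have a'_eq: "a' = c *\<^sub>R a i" by (simp add: v_def)
  have "b' = c * b i" using fq g_witness[OF i(1)] by (simp add: f_eq g_def a'_eq flip: distrib_left) algebra
  then have "f = (\<lambda>x. c * g i x)" by (simp add: f_eq g_def a'_eq distrib_left)
  moreover have "0 \<le> c" unfolding c_def using key[of "a i"] ai by simp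
  ultimately show ?thesis using that i(1) by blast
qed

end

text \<open>In a minimal family of halfplanes, dropping \<open>h\<close> admits a point
  \<open>y\<close> outside \<open>P\<close>. The segment from an interior point \<open>z\<close> to
  \<open>y\<close> leaves \<open>h\<close> at a point strictly inside all other halfplanes, which is
  the witness.\<close>

lemma irredundant_of_polygon:
  assumes "polygon P"
  obtains I :: "(real^2) set set" and a b q
    where "irredundant_halfplanes I a b q" "P = irredundant_halfplanes.P I a b"
proof -
  have aff: "affine hull P = UNIV"
    using assms affine_hull_nonempty_interior unfolding polygon_def by blast
  have "\<exists>F. finite F \<and> P = (affine hull P) \<inter> \<Inter>F \<and>
              (\<forall>h \<in> F. \<exists>a b. a \<noteq> 0 \<and> h = {x. a \<bullet> x \<le> b}) \<and>
              (\<forall>F'. F' \<subset> F \<longrightarrow> P \<subset> (affine hull P) \<inter> \<Inter>F')"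
    using assms unfolding polygon_def polyhedron_Int_affine_minimal by blast
  then obtain F where F: "finite F" "P = \<Inter>F"
      "\<And>h. h \<in> F \<Longrightarrow> \<exists>a b. a \<noteq> 0 \<and> h = {x. a \<bullet> x \<le> b}"
      and minimal: "\<And>F'. F' \<subset> F \<Longrightarrow> P \<subset> \<Inter>F'"
    unfolding aff by auto
  have "\<exists>a b. a \<noteq> 0 \<and> (\<forall>x. x \<in> h \<longleftrightarrow> a \<bullet> x \<le> b)" if h: "h \<in> F" for h
  proof -
    obtain a b where "a \<noteq> 0" and "h = {x. a \<bullet> x \<le> b}" using F(3)[OF h] by blast
    then show ?thesis by (intro exI[of _ a] exI[of _ b]) simp
  qed
  then obtain a' b' where ab_nz: "\<And>h. h \<in> F \<Longrightarrow> a' h \<noteq> 0"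
      and ab_iff: "\<And>h x. h \<in> F \<Longrightarrow> x \<in> h \<longleftrightarrow> a' h \<bullet> x \<le> b' h"
    by metis
  obtain z where z: "z \<in> interior P" using assms unfolding polygon_def by blast
  have z_pos: "a' h \<bullet> z < b' h" if "h \<in> F" for h
  proof -
    have "P \<subseteq> {x. a' h \<bullet> x \<le> b' h}" using that F(2) ab_iff by blast
    then have "z \<in> interior {x. a' h \<bullet> x \<le> b' h}" using z interior_mono by blast
    then show ?thesis using ab_nz[OF that] by (simp add: interior_halfspace_le)
  qed
  have "\<exists>x. a' h \<bullet> x = b' h \<and> (\<forall>h'\<in>F - {h}. a' h' \<bullet> x < b' h')" if h: "h \<in> F" for h
  proof -
    obtain y where y: "y \<in> \<Inter>(F - {h})" "y \<notin> P"
      using minimal[of "F - {h}"] h by blast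
    have y_out: "b' h < a' h \<bullet> y"
    proof (rule ccontr)
      assume "\<not> b' h < a' h \<bullet> y"
      then have "y \<in> h" using ab_iff[OF h] by auto
      then show False using y F(2) by blast
    qed
    \<comment> \<open>The parameter at which the segment from \<open>z\<close> to \<open>y\<close>
      crosses the boundary line of \<open>h\<close>.\<close>
    define t where "t = (b' h - a' h \<bullet> z) / (a' h \<bullet> y - a' h \<bullet> z)"
    have t: "0 < t" "t < 1" using y_out z_pos[OF h] by (auto simp: t_def field_simps)
    let ?x = "(1 - t) *\<^sub>R z + t *\<^sub>R y"
    have val: "a' h' \<bullet> ?x = (1 - t) * (a' h' \<bullet> z) + t * (a' h' \<bullet> y)" for h'
      by (simp add: inner_add_right)
    have "a' h \<bullet> ?x = a' h \<bullet> z + t * (a' h \<bullet> y - a' h \<bullet> z)"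
      unfolding val by (simp add: algebra_simps)
    also have "\<dots> = b' h" using y_out z_pos[OF h] by (simp add: t_def)
    finally have "a' h \<bullet> ?x = b' h" .
    moreover have "a' h' \<bullet> ?x < b' h'" if h': "h' \<in> F - {h}" for h'
    proof -
      have "y \<in> h'" using y h' by blast
      then have "a' h' \<bullet> y \<le> b' h'" using ab_iff h' by blast
      then have "t * (a' h' \<bullet> y) \<le> t * b' h'" using t by simp
      moreover have "(1 - t) * (a' h' \<bullet> z) < (1 - t) * b' h'" using t z_pos h' by simp
      ultimately show ?thesis unfolding val by (simp add: algebra_simps)
    qed
    ultimately show ?thesis by blast
  qed
  then obtain q where q: "\<And>h. h \<in> F \<Longrightarrow> a' h \<bullet> q h = b' h"
      "\<And>h h'. h \<in> F \<Longrightarrow> h' \<in> F - {h} \<Longrightarrow> a' h' \<bullet> q h < b' h'"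
    by metis
  have irr: "irredundant_halfplanes F (\<lambda>h. - a' h) b' q"
    using F(1) ab_nz q z_pos by unfold_locales (auto intro!: exI[of _ z])
  moreover have "P = irredundant_halfplanes.P F (\<lambda>h. - a' h) b'"
    unfolding irredundant_halfplanes.P_def[OF irr] irredundant_halfplanes.g_def[OF irr]
    using F(2) ab_iff by auto
  ultimately show ?thesis by (rule that)
qed

section \<open>Lower bounds\<close>

lemma real_polynomial_function_affine: "affine_function f \<Longrightarrow> real_polynomial_function f"
  unfolding affine_function_def by (auto intro!: bounded_linear_inner_right)

lemma real_polynomial_function_cond_C:
  assumes "cond_C k P n p" "i \<in> {1..n}"
  shows "real_polynomial_function (p i)"
proof -
  obtain r and f :: "nat \<Rightarrow> real^2 \<Rightarrow> real" where "p i = (\<lambda>x. \<Prod>j=1..r. f j x)"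
      "\<forall>j\<in>{1..r}. affine_function (f j) \<and> (\<forall>x\<in>P. f j x \<ge> 0) \<and>
                     (\<exists>e\<in>edges P. \<forall>x\<in>e. f j x = 0)"
    using bspec[OF assms(1)[unfolded cond_C_def] assms(2)] by (elim exE conjE)
  then show ?thesis
    using real_polynomial_function_prod[of "{1..r}" "\<lambda>x j. f j x"]
    by (simp add: real_polynomial_function_affine)
qed

lemma prod_pos_iff_even_negative:
  fixes f :: "'a \<Rightarrow> real"
  assumes "finite S" "\<And>j. j \<in> S \<Longrightarrow> f j \<noteq> 0"
  shows "0 < prod f S \<longleftrightarrow> even (card {j \<in> S. f j < 0})"
  using assms
proof (induction S rule: finite_induct)
  case (insert x S)
  have "{j \<in> insert x S. f j < 0} = (if f x < 0 then insert x {j \<in> S. f j < 0} else {j \<in> S. f j < 0})"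
    by auto
  moreover have "prod f S \<noteq> 0" "f x \<noteq> 0" using insert by auto
  then have "prod f S < 0 \<or> 0 < prod f S" "f x < 0 \<or> 0 < f x" by linarith+
  moreover have "0 < prod f S \<longleftrightarrow> even (card {j \<in> S. f j < 0})" using insert by blast
  ultimately show ?case
    using insert(1,2) by (auto simp: zero_less_mult_iff)
qed simp

context irredundant_halfplanes
begin

lemma cond_C_factors:
  assumes "cond_C k P n p" "i \<in> {1..n}"
  obtains r l C where "r \<le> k" "l ` {1..r} \<subseteq> I" "0 \<le> C" "p i = (\<lambda>x. C * (\<Prod>j=1..r. g (l j) x))"
proof -
  obtain r f where r: "r \<le> k" and p: "p i = (\<lambda>x. \<Prod>j=1..r. f j x)"
    and f: "\<forall>j\<in>{1..r}. affine_function (f j) \<and> (\<forall>x\<in>P. 0 \<le> f j x) \<and>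
                     (\<exists>e\<in>edges P. \<forall>x\<in>e. f j x = 0)"
    using bspec[OF assms(1)[unfolded cond_C_def] assms(2)] by (elim exE conjE)
  have "\<exists>i c. i \<in> I \<and> 0 \<le> c \<and> f j = (\<lambda>x. c * g i x)" if "j \<in> {1..r}" for j
    using supporting_affine[of "f j"] f that by metis
  then obtain l c where lc: "\<And>j. j \<in> {1..r} \<Longrightarrow> l j \<in> I \<and> 0 \<le> c j \<and> f j = (\<lambda>x. c j * g (l j) x)"
    by metis
  have "p i = (\<lambda>x. (\<Prod>j=1..r. c j) * (\<Prod>j=1..r. g (l j) x))"
    unfolding p prod.distrib[symmetric] by (intro ext prod.cong) (use lc in auto)
  moreover have "0 \<le> (\<Prod>j=1..r. c j)" using lc by (intro prod_nonneg) auto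
  ultimately show ?thesis using that[of r l] r lc by blast
qed

lemma cond_A_C_factors:
  assumes "cond_A P n p" "cond_C k P n p"
  obtains r l C where "\<forall>i\<in>{1..n}. r i \<le> k \<and> l i ` {1..r i} \<subseteq> I \<and> 0 < C i \<and>
    p i = (\<lambda>x. C i * (\<Prod>j=1..r i. g (l i j) x))"
proof -
  have "\<exists>r l C. r \<le> k \<and> l ` {1..r} \<subseteq> I \<and> 0 < C \<and> p i = (\<lambda>x. C * (\<Prod>j=1..r. g (l j) x))"
    if i: "i \<in> {1..n}" for i
  proof -
    obtain r l C where rlC: "r \<le> k" "l ` {1..r} \<subseteq> I" "0 \<le> C" "p i = (\<lambda>x. C * (\<Prod>j=1..r. g (l j) x))"
      by (rule cond_C_factors[OF assms(2) i])
    \<comment> \<open>Positivity at an interior point excludes a zero factor, hence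
      \<open>C = 0\<close>.\<close>
    obtain z where "z \<in> interior P" using interior_P_nonempty by blast
    then have "0 < p i z" using assms(1) i unfolding cond_A_def by blast
    then have "C \<noteq> 0" unfolding rlC(4) by auto
    then show ?thesis using rlC by (metis less_eq_real_def)
  qed
  then show ?thesis using that by metis
qed

lemma card_le_of_cond_A_C:
  assumes A: "cond_A P n p" and C: "cond_C k P n p"
  shows "card I \<le> n * k"
proof -
  obtain r l C where *: "\<forall>i\<in>{1..n}. r i \<le> k \<and> l i ` {1..r i} \<subseteq> I \<and> 0 < C i \<and>
      p i = (\<lambda>x. C i * (\<Prod>j=1..r i. g (l i j) x))"
    by (rule cond_A_C_factors[OF A C])
  have r: "r i \<le> k" and l: "l i ` {1..r i} \<subseteq> I" and C: "0 < C i"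
    and p: "p i = (\<lambda>x. C i * (\<Prod>j=1..r i. g (l i j) x))" if "i \<in> {1..n}" for i
    using * that by blast+
  have "I \<subseteq> (\<Union>i\<in>{1..n}. l i ` {1..r i})"
  proof
    fix h assume h: "h \<in> I"
    show "h \<in> (\<Union>i\<in>{1..n}. l i ` {1..r i})"
    proof (rule ccontr)
      assume not: "h \<notin> (\<Union>i\<in>{1..n}. l i ` {1..r i})"
      \<comment> \<open>All factors belong to other edges, hence are positive at the witness of
        \<open>h\<close>.\<close>
      have "0 < p i (q h)" if i: "i \<in> {1..n}" for i
      proof -
        have "0 < g (l i j) (q h)" if j: "j \<in> {1..r i}" for j
        proof -
          have "l i j \<in> I" "l i j \<noteq> h" using i j l[OF i] not by blast+
          then show ?thesis using g_witness_pos h by blast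
        qed
        then show ?thesis unfolding p[OF i] using C[OF i] by (intro mult_pos_pos prod_pos) auto
      qed
      then have "q h \<in> interior P" using A unfolding cond_A_def by blast
      then show False using h g_witness[OF h] by (force simp: interior_P)
    qed
  qed
  then have "card I \<le> card (\<Union>i\<in>{1..n}. l i ` {1..r i})" by (intro card_mono) auto
  also have "\<dots> \<le> (\<Sum>i\<in>{1..n}. card (l i ` {1..r i}))" by (intro card_UN_le) auto
  also have "\<dots> \<le> (\<Sum>i\<in>{1..n}. k)"
    using r by (intro sum_mono) (metis card_atLeastAtMost card_image_le diff_Suc_1 finite_atLeastAtMost le_trans)
  finally show ?thesis by simp
qed

text \<open>A polynomial that is not identically zero is positive on the interior, being a positive
  multiple of a product of functions \<open>g j\<close>. Conversely, the set where all are positive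
  is open and contained in \<open>P\<close>. Zero polynomials, harmless for the weak inequalities,
  are replaced by a nonzero one.\<close>

lemma cond_A_of_cond_Abar:
  assumes Abar: "cond_Abar P n p" and C: "cond_C k P n p" and "I \<noteq> {}"
  obtains p' where "cond_A P n p'" "cond_C k P n p'"
proof -
  obtain h where h: "h \<in> I" using \<open>I \<noteq> {}\<close> by blast
  obtain t :: real where "0 < t" "g h (q h + t *\<^sub>R (- a h)) = t * (a h \<bullet> (- a h))"
    using move_off_witness[OF h] by blast
  then have "g h (q h + t *\<^sub>R (- a h)) < 0" using a_nonzero[OF h] by simp
  \<comment> \<open>If all polynomials were zero, the weak inequalities would describe the whole
    plane.\<close>
  then have "P \<noteq> UNIV" using P_nonneg[OF h] by (metis UNIV_I not_le)
  then obtain i0 where i0: "i0 \<in> {1..n}" "p i0 \<noteq> (\<lambda>_. 0)"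
    using Abar unfolding cond_Abar_def by force
  define p' where "p' i = (if p i = (\<lambda>_. 0) then p i0 else p i)" for i
  have C': "cond_C k P n p'"
    using C i0 unfolding cond_C_def p'_def by auto
  have ne: "p' i \<noteq> (\<lambda>_. 0)" for i using i0 by (simp add: p'_def)
  have "interior P = {x. \<forall>i\<in>{1..n}. p' i x > 0}"
  proof
    show "interior P \<subseteq> {x. \<forall>i\<in>{1..n}. p' i x > 0}"
    proof clarify
      fix x i assume x: "x \<in> interior P" and i: "i \<in> {1..n}"
      obtain r l C where rlC: "r \<le> k" "l ` {1..r} \<subseteq> I" "0 \<le> C"
          "p' i = (\<lambda>x. C * (\<Prod>j=1..r. g (l j) x))"
        by (rule cond_C_factors[OF C' i])
      have "C \<noteq> 0" using ne[of i] rlC(4) by auto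
      moreover have "0 < (\<Prod>j=1..r. g (l j) x)"
        using x rlC(2) by (intro prod_pos) (auto simp: interior_P image_subset_iff)
      ultimately show "0 < p' i x" using rlC(3,4) by simp
    qed
    have "continuous_on UNIV (p' i)" if "i \<in> {1..n}" for i
      using real_polynomial_function_cond_C[OF C' that]
      by (intro continuous_at_imp_continuous_on ballI) (rule continuous_real_polymonial_function)
    then have "open {x. 0 < p' i x}" if "i \<in> {1..n}" for i
      using that by (intro open_Collect_less) auto
    moreover have "{x. \<forall>i\<in>{1..n}. p' i x > 0} = (\<Inter>i\<in>{1..n}. {x. 0 < p' i x})" by auto
    ultimately have "open {x. \<forall>i\<in>{1..n}. p' i x > 0}" by (simp add: open_INT)
    moreover have "{x. \<forall>i\<in>{1..n}. p' i x > 0} \<subseteq> P"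
    proof
      fix x assume x: "x \<in> {x. \<forall>i\<in>{1..n}. p' i x > 0}"
      have "0 \<le> p i x" if "i \<in> {1..n}" for i
      proof (cases "p i = (\<lambda>_. 0)")
        case False
        then have "p i x = p' i x" by (simp add: p'_def)
        moreover have "0 < p' i x" using x that by blast
        ultimately show ?thesis by simp
      qed simp
      then show "x \<in> P" using Abar unfolding cond_Abar_def by blast
    qed
    ultimately show "{x. \<forall>i\<in>{1..n}. p' i x > 0} \<subseteq> interior P" by (rule interior_maximal[rotated])
  qed
  then have "cond_A P n p'" by (simp add: cond_A_def)
  then show ?thesis using that C' by blast
qed

end

section \<open>The polygon of tangents to a parabola\<close>

lemma inner_real2: "x \<bullet> y = x $ 1 * y $ 1 + x $ 2 * y $ 2" for x y :: "real^2"
  by (simp add: inner_vec_def sum_2)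

text \<open>The \<open>l\<close>-th halfplane lies above the tangent of the parabola \<open>y = x\<^sup>2\<close> at \<open>(l, l\<^sup>2)\<close>:
  its affine function is \<open>y - x\<^sup>2 + (x - l)\<^sup>2\<close>.\<close>

interpretation tangents: irredundant_halfplanes "{..<m}" "\<lambda>l. vector [- (2 * real l), 1]"
    "\<lambda>l. (real l)\<^sup>2" "\<lambda>l. vector [real l, (real l)\<^sup>2]" for m :: nat
proof
  show "(vector [- (2 * real l), 1] :: real^2) \<noteq> 0" for l
    by (simp add: vec_eq_iff forall_2)
  show "(0::real) < vector [- (2 * real j), 1] \<bullet> (vector [real i, (real i)\<^sup>2] :: real^2) + (real j)\<^sup>2"
    if "j \<noteq> i" for i j :: nat
  proof -
    have "0 < (real i - real j)\<^sup>2" using that by simp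
    then show ?thesis by (simp add: inner_real2 power2_eq_square algebra_simps)
  qed
  \<comment> \<open>The point (0, 1) lies above the parabola, hence above all its tangents.\<close>
  show "\<exists>x::real^2. \<forall>i\<in>{..<m}. 0 < vector [- (2 * real i), 1] \<bullet> x + (real i)\<^sup>2"
    by (intro exI[of _ "vector [0, 1]"]) (auto simp: inner_real2 intro: add_pos_nonneg)
qed (auto simp: inner_real2 power2_eq_square)

lemma tangents_g: "tangents.g l x = x $ 2 - (x $ 1)\<^sup>2 + (x $ 1 - real l)\<^sup>2"
  unfolding tangents.g_def by (simp add: inner_real2 power2_eq_square algebra_simps)

text \<open>At \<open>(c, c\<^sup>2 - R\<^sup>2)\<close> the \<open>l\<close>-th function is
  \<open>(c - l)\<^sup>2 - R\<^sup>2\<close>, negative exactly for \<open>l\<close> within distance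
  \<open>R\<close> of \<open>c\<close>. The endpoints \<open>t - 1/2\<close> and
  \<open>t' - 1/2\<close> of this range are half-integers, so no value vanishes.\<close>

lemma tangents_separate:
  assumes "t < t'"
  obtains z where "\<And>l. tangents.g l z \<noteq> 0" "\<And>l. tangents.g l z < 0 \<longleftrightarrow> t \<le> l \<and> l < t'"
proof -
  define c where "c = (real t + real t' - 1) / 2"
  define R where "R = (real t' - real t) / 2"
  define z :: "real^2" where "z = vector [c, c\<^sup>2 - R\<^sup>2]"
  have g: "tangents.g l z = (c - real l)\<^sup>2 - R\<^sup>2" for l
    unfolding tangents_g by (simp add: z_def)
  have g': "tangents.g l z = (real t - 1/2 - real l) * (real t' - 1/2 - real l)" for l
    unfolding g by (simp add: c_def R_def power2_eq_square field_simps)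
  have "real t - 1/2 - real l < 0 \<longleftrightarrow> t \<le> l" "real t' - 1/2 - real l < 0 \<longleftrightarrow> t' \<le> l"
    "real t - 1/2 - real l \<noteq> 0" "real t' - 1/2 - real l \<noteq> 0" for l
    using of_nat_le_iff[of t l, where ?'a = real] of_nat_le_iff[of t' l, where ?'a = real]
      of_nat_le_iff[of "l + 1" t, where ?'a = real] of_nat_le_iff[of "l + 1" t', where ?'a = real]
    by (cases "t \<le> l"; cases "t' \<le> l"; simp)+
  then have "tangents.g l z \<noteq> 0" "tangents.g l z < 0 \<longleftrightarrow> t \<le> l \<and> l < t'" for l
    unfolding g' mult_less_0_iff mult_eq_0_iff using assms
    by (simp_all add: order_less_le not_le) linarith+
  then show ?thesis by (rule that)
qed

lemma tangents_lower_bound: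
  assumes A: "cond_A (tangents.P m) n p" and C: "cond_C k (tangents.P m) n p"
  shows "m + 1 \<le> 2 ^ n"
proof -
  obtain r l C where *: "\<forall>i\<in>{1..n}. r i \<le> k \<and> l i ` {1..r i} \<subseteq> {..<m} \<and> 0 < C i \<and>
      p i = (\<lambda>x. C i * (\<Prod>j=1..r i. tangents.g (l i j) x))"
    by (rule tangents.cond_A_C_factors[OF A C])
  have C: "0 < C i" and p: "p i = (\<lambda>x. C i * (\<Prod>j=1..r i. tangents.g (l i j) x))"
    if "i \<in> {1..n}" for i
    using * that by blast+
  \<comment> \<open>Factors are counted with multiplicity, since a tangent may occur repeatedly in
    one polynomial; \<open>\<sigma> t\<close> encodes the parity vector as a subset of
    \<open>{1..n}\<close>.\<close>
  define S where "S i t = {j \<in> {1..r i}. l i j < t}" for i and t :: nat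
  define \<sigma> where "\<sigma> t = {i \<in> {1..n}. odd (card (S i t))}" for t
  have "\<sigma> t \<noteq> \<sigma> t'" if t: "t < t'" "t' \<le> m" for t t'
  proof
    assume eq: "\<sigma> t = \<sigma> t'"
    obtain z where z: "\<And>l. tangents.g l z \<noteq> 0" "\<And>l. tangents.g l z < 0 \<longleftrightarrow> t \<le> l \<and> l < t'"
      using tangents_separate[OF t(1)] by metis
    have "0 < p i z" if i: "i \<in> {1..n}" for i
    proof -
      \<comment> \<open>Equal parities make the number of factors negative at \<open>z\<close> even,
        so \<open>p i z\<close> is positive although \<open>z\<close> violates tangent
        \<open>t\<close>.\<close>
      have "{j \<in> {1..r i}. tangents.g (l i j) z < 0} = S i t' - S i t"
        by (auto simp: S_def z(2))
      moreover have "S i t \<subseteq> S i t'" using t(1) by (auto simp: S_def)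
      then have "card (S i t' - S i t) = card (S i t') - card (S i t)" "card (S i t) \<le> card (S i t')"
        by (auto simp: S_def card_Diff_subset card_mono)
      moreover have "odd (card (S i t)) \<longleftrightarrow> odd (card (S i t'))"
        using eq i unfolding \<sigma>_def by blast
      ultimately have "even (card {j \<in> {1..r i}. tangents.g (l i j) z < 0})" by simp
      then have "0 < (\<Prod>j=1..r i. tangents.g (l i j) z)"
        using z(1) by (subst prod_pos_iff_even_negative) auto
      then show ?thesis unfolding p[OF i] using C[OF i] by simp
    qed
    then have "z \<in> interior (tangents.P m)" using A unfolding cond_A_def by blast
    then have "0 < tangents.g t z" using t by (auto simp: tangents.interior_P)
    then show False using z(2)[of t] t(1) by simp
  qed
  then have "inj_on \<sigma> {..m}" by (intro linorder_inj_onI) auto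
  moreover have "\<sigma> ` {..m} \<subseteq> Pow {1..n}" by (auto simp: \<sigma>_def)
  ultimately have "card {..m} \<le> card (Pow {1..n})" by (intro card_inj_on_le) auto
  then show ?thesis by (simp add: card_Pow)
qed

section \<open>The order of the edges\<close>

lemma irredundant_halfplanes_scale:
  assumes "irredundant_halfplanes I a b q" and c: "\<And>i. i \<in> I \<Longrightarrow> 0 < c i"
  shows "irredundant_halfplanes I (\<lambda>i. c i *\<^sub>R a i) (\<lambda>i. c i * b i) q"
    and "irredundant_halfplanes.P I (\<lambda>i. c i *\<^sub>R a i) (\<lambda>i. c i * b i) = irredundant_halfplanes.P I a b"
proof -
  interpret irredundant_halfplanes I a b q by fact
  have eq: "(c i *\<^sub>R a i) \<bullet> x + c i * b i = c i * g i x" for i x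
    by (simp add: g_def distrib_left)
  show irr: "irredundant_halfplanes I (\<lambda>i. c i *\<^sub>R a i) (\<lambda>i. c i * b i) q"
  proof
    obtain x where "\<forall>i\<in>I. 0 < g i x" using ex_inner unfolding g_def by blast
    then show "\<exists>x. \<forall>i\<in>I. 0 < (c i *\<^sub>R a i) \<bullet> x + c i * b i"
      unfolding eq using c by (intro exI[of _ x]) simp
    show "c i *\<^sub>R a i \<noteq> 0" if "i \<in> I" for i using a_nonzero[OF that] c[OF that] by simp
    show "(c i *\<^sub>R a i) \<bullet> q i + c i * b i = 0" if "i \<in> I" for i
      unfolding eq using g_witness[OF that] by simp
    show "0 < (c j *\<^sub>R a j) \<bullet> q i + c j * b j" if "i \<in> I" "j \<in> I" "j \<noteq> i" for i j
      unfolding eq using g_witness_pos that c by simp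
  qed (rule finite_I)
  have "0 \<le> c i * g i x \<longleftrightarrow> 0 \<le> g i x" if "i \<in> I" for i x
    using c[OF that] by (simp add: zero_le_mult_iff)
  then show "irredundant_halfplanes.P I (\<lambda>i. c i *\<^sub>R a i) (\<lambda>i. c i * b i) = P"
    unfolding irredundant_halfplanes.P_def[OF irr] irredundant_halfplanes.g_def[OF irr] P_def eq
    by simp
qed

text \<open>Two functions whose normals have the same second coordinate differ by a function of
  \<open>x $ 1\<close> alone; after this normalization, comparing them becomes a one-dimensional
  question.\<close>

locale normalized_halfplanes = irredundant_halfplanes I a b q
  for I :: "'i set" and a b q +
  assumes normalized: "i \<in> I \<Longrightarrow>
    a i $ 2 = 1 \<or> a i $ 2 = -1 \<or> a i $ 2 = 0 \<and> (a i $ 1 = 1 \<or> a i $ 1 = -1)"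
begin

text \<open>Sorts the halfplanes with \<open>a i $ 2 = 1\<close> first, then those with \<open>-1\<close>, then those with \<open>0\<close>,
  and by slope inside the first two classes.\<close>

definition key :: "'i \<Rightarrow> real" where
  "key i = (if a i $ 2 = 1 then arctan (a i $ 1)
    else if a i $ 2 = -1 then 4 + arctan (a i $ 1) else 8 + a i $ 1)"

text \<open>These edges get a polynomial of their own. If a point violates none of them but violates
  some other inequality, then its first coordinate lies in the projection of \<open>P\<close>, so it cannot
  violate inequalities with \<open>a i $ 2 = 1\<close> and with \<open>a i $ 2 = -1\<close> at once.\<close>

definition isolated :: "'i set" where
  "isolated = {i \<in> I. a i $ 2 = 0 \<or> (\<forall>j\<in>I. a j $ 2 = a i $ 2 \<longrightarrow> a i $ 1 \<le> a j $ 1) \<or>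
     (\<forall>j\<in>I. a j $ 2 = a i $ 2 \<longrightarrow> a j $ 1 \<le> a i $ 1)}"

lemma g_coords: "g i x = a i $ 1 * x $ 1 + a i $ 2 * x $ 2 + b i"
  by (simp add: g_def inner_real2)

lemma arctan_range: "-2 < arctan x" "arctan x < 2"
  using arctan_bounded[of x] pi_less_4 by linarith+

text \<open>Since \<open>arctan\<close> stays in (-2, 2) and preserves order, the offsets 4 and 8
  place the three classes in (-2, 2), (2, 6) and {7, 9}.\<close>

lemma key_class:
  assumes "i \<in> I"
  shows "a i $ 2 = 1 \<longleftrightarrow> -2 < key i \<and> key i < 2" "a i $ 2 = -1 \<longleftrightarrow> 2 < key i \<and> key i < 6"
    "a i $ 2 = 0 \<longleftrightarrow> 6 < key i"
  using normalized[OF assms] arctan_range[of "a i $ 1"] by (auto simp: key_def)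

lemma key_less_iff:
  assumes "i \<in> I" "j \<in> I" "a i $ 2 = a j $ 2"
  shows "key i < key j \<longleftrightarrow> a i $ 1 < a j $ 1"
  using normalized[OF assms(1)] normalized[OF assms(2)] assms(3)
  by (auto simp: key_def arctan_less_iff)

text \<open>Two functions with the same normal differ by a constant, which would have opposite signs
  at \<open>q i\<close> and \<open>q j\<close>.\<close>

lemma inj_a: "inj_on a I"
proof (rule inj_onI, rule ccontr)
  fix i j assume *: "i \<in> I" "j \<in> I" "a i = a j" "i \<noteq> j"
  have "g i (q j) - g i (q i) = g j (q j) - g j (q i)" by (simp add: g_def *(3))
  then show False
    using g_witness[OF *(1)] g_witness[OF *(2)] g_witness_pos[OF *(1,2)] g_witness_pos[OF *(2,1)] *(4)
    by auto
qed

lemma a_eqI: "\<lbrakk>i \<in> I; j \<in> I; a i $ 1 = a j $ 1; a i $ 2 = a j $ 2\<rbrakk> \<Longrightarrow> i = j"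
  using inj_a by (auto simp: inj_on_def vec_eq_iff forall_2)

lemma inj_key: "inj_on key I"
proof (rule inj_onI)
  fix i j assume *: "i \<in> I" "j \<in> I" "key i = key j"
  have "a i $ 2 = 1 \<longleftrightarrow> a j $ 2 = 1" "a i $ 2 = -1 \<longleftrightarrow> a j $ 2 = -1" "a i $ 2 = 0 \<longleftrightarrow> a j $ 2 = 0"
    by (simp_all only: key_class[OF *(1)] key_class[OF *(2)] *(3))
  then have eq: "a i $ 2 = a j $ 2" using normalized[OF *(1)] by (elim disjE conjE) simp_all
  then have "\<not> a i $ 1 < a j $ 1" "\<not> a j $ 1 < a i $ 1"
    using key_less_iff[OF *(1,2)] key_less_iff[OF *(2,1)] *(3) by simp_all
  then show "i = j" using a_eqI[OF *(1,2)] eq by linarith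
qed

lemma slope_diff:
  assumes "a i $ 2 = a j $ 2"
  shows "(g i x - g j x) - (g i y - g j y) = (a i $ 1 - a j $ 1) * (x $ 1 - y $ 1)"
  using assms by (simp add: g_coords algebra_simps)

text \<open>\<open>g i - g j\<close> increases with the first coordinate and is positive at
  \<open>q j\<close>, so it can be non-positive only to the left of \<open>q j\<close>.\<close>

lemma left_of_witness:
  assumes "i \<in> I" "j \<in> I" "a i $ 2 = a j $ 2" "a j $ 1 < a i $ 1" "g i z \<le> g j z"
  shows "z $ 1 < q j $ 1"
proof -
  have "j \<noteq> i" using assms(4) by auto
  then have "0 < g i (q j)" using g_witness_pos assms by blast
  then have "(a i $ 1 - a j $ 1) * (z $ 1 - q j $ 1) < 0"
    using slope_diff[OF assms(3), of z "q j"] g_witness[OF assms(2)] assms(5) by linarith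
  then show ?thesis using assms(4) by (simp add: mult_less_0_iff)
qed

lemma right_of_witness:
  assumes "i \<in> I" "j \<in> I" "a i $ 2 = a j $ 2" "a i $ 1 < a j $ 1" "g i z \<le> g j z"
  shows "q j $ 1 < z $ 1"
proof -
  have "j \<noteq> i" using assms(4) by auto
  then have "0 < g i (q j)" using g_witness_pos assms by blast
  then have "(a i $ 1 - a j $ 1) * (z $ 1 - q j $ 1) < 0"
    using slope_diff[OF assms(3), of z "q j"] g_witness[OF assms(2)] assms(5) by linarith
  then show ?thesis using assms(4) by (simp add: mult_less_0_iff)
qed

text \<open>If \<open>g j z\<close> were non-negative, comparison with the smaller slope of
  \<open>i\<close> would put \<open>z\<close> to the right of \<open>q j\<close>, and comparison
  with the larger slope of \<open>l\<close> to the left.\<close>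

lemma violated_between:
  assumes I: "i \<in> I" "j \<in> I" "l \<in> I" and less: "key i < key j" "key j < key l"
    and cl: "a i $ 2 = a l $ 2" "a i $ 2 \<noteq> 0" and z: "g i z \<le> 0" "g l z \<le> 0"
  shows "g j z < 0"
proof (rule ccontr)
  assume "\<not> g j z < 0"
  consider "a i $ 2 = 1" | "a i $ 2 = -1" using normalized[OF I(1)] cl(2) by blast
  then have j: "a j $ 2 = a i $ 2"
  proof cases
    case 1
    then show ?thesis
      using key_class(1)[OF I(1)] key_class(1)[OF I(2)] key_class(1)[OF I(3)] less cl(1) by simp
  next
    case 2
    then show ?thesis
      using key_class(2)[OF I(1)] key_class(2)[OF I(2)] key_class(2)[OF I(3)] less cl(1) by simp
  qed
  have "q j $ 1 < z $ 1"
    using right_of_witness[of i j z] I j key_less_iff[of i j] less z \<open>\<not> g j z < 0\<close> by simp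
  moreover have "z $ 1 < q j $ 1"
    using left_of_witness[of l j z] I j cl key_less_iff[of j l] less z \<open>\<not> g j z < 0\<close> by simp
  ultimately show False by simp
qed

text \<open>There are two possible normals of vertical edges, and a smallest and a largest slope in
  each of the other two classes; each belongs to at most one edge.\<close>

lemma card_isolated: "card isolated \<le> 6"
proof -
  define X where "X Q = {i \<in> I. Q i}" for Q :: "'i \<Rightarrow> bool"
  have card_X: "card (X Q) \<le> 1" if "\<And>i j. \<lbrakk>i \<in> I; j \<in> I; Q i; Q j\<rbrakk> \<Longrightarrow> a i $ 1 = a j $ 1 \<and> a i $ 2 = a j $ 2" for Q
    using that a_eqI finite_I unfolding One_nat_def X_def
    by (subst card_le_Suc0_iff_eq) auto
  let ?lo = "\<lambda>c i. a i $ 2 = c \<and> (\<forall>j\<in>I. a j $ 2 = c \<longrightarrow> a i $ 1 \<le> a j $ 1)"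
  let ?hi = "\<lambda>c i. a i $ 2 = c \<and> (\<forall>j\<in>I. a j $ 2 = c \<longrightarrow> a j $ 1 \<le> a i $ 1)"
  let ?v = "\<lambda>d i. a i $ 2 = 0 \<and> a i $ 1 = d"
  have "isolated \<subseteq> X (?v 1) \<union> X (?v (-1)) \<union> X (?lo 1) \<union> X (?lo (-1)) \<union> X (?hi 1) \<union> X (?hi (-1))"
  proof
    fix i assume i: "i \<in> isolated"
    then have "i \<in> I" by (simp add: isolated_def)
    from normalized[OF this] i
    show "i \<in> X (?v 1) \<union> X (?v (-1)) \<union> X (?lo 1) \<union> X (?lo (-1)) \<union> X (?hi 1) \<union> X (?hi (-1))"
      unfolding isolated_def X_def by auto
  qed
  then have "card isolated \<le> card (X (?v 1) \<union> X (?v (-1)) \<union> X (?lo 1) \<union> X (?lo (-1)) \<union> X (?hi 1) \<union> X (?hi (-1)))"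
    using finite_I by (intro card_mono) (auto simp: X_def)
  also have "\<dots> \<le> card (X (?v 1)) + card (X (?v (-1))) + card (X (?lo 1)) + card (X (?lo (-1)))
      + card (X (?hi 1)) + card (X (?hi (-1)))"
    by (intro order_trans[OF card_Un_le] add_mono order_refl)
  also have "\<dots> \<le> 1 + 1 + 1 + 1 + 1 + 1"
    by (intro add_mono card_X) (auto intro: antisym)
  finally show ?thesis by simp
qed

text \<open>The edges \<open>e1\<close>, \<open>e2\<close> of extreme slope in the class of
  \<open>h\<close> are isolated, hence satisfied at \<open>z\<close>, which puts \<open>z\<close>
  horizontally between their witnesses. So \<open>P\<close> has a point \<open>y\<close> on the
  vertical line through \<open>z\<close>. The sum \<open>g h + g u\<close> depends on the first
  coordinate only and is non-negative at \<open>y\<close>; thus \<open>g h z < 0\<close> forces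
  \<open>0 < g u z\<close>.\<close>

lemma opposite_not_violated:
  assumes h: "h \<in> I" "h \<notin> isolated" "g h z < 0" and u: "u \<in> I" "a u $ 2 = - a h $ 2"
    and iso: "\<And>i. i \<in> isolated \<Longrightarrow> 0 \<le> g i z"
  shows "0 < g u z"
proof -
  define K where "K = {i \<in> I. a i $ 2 = a h $ 2}"
  have K: "finite K" "h \<in> K" using finite_I h by (auto simp: K_def)
  let ?s = "\<lambda>i. a i $ 1"
  have fin: "finite (?s ` K)" "?s ` K \<noteq> {}" using K by auto
  obtain e1 e2 where e: "e1 \<in> K" "e2 \<in> K" "?s e1 = Min (?s ` K)" "?s e2 = Max (?s ` K)"
    using Min_in[OF fin] Max_in[OF fin] by (elim imageE) simp
  have le: "?s e1 \<le> ?s i" "?s i \<le> ?s e2" if "i \<in> K" for i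
    using e(3,4) K that by auto
  have eI: "e1 \<in> I" "e2 \<in> I" "a e1 $ 2 = a h $ 2" "a e2 $ 2 = a h $ 2"
    using e by (auto simp: K_def)
  have e_iso: "e1 \<in> isolated" "e2 \<in> isolated"
    using le eI by (auto simp: isolated_def K_def)
  then have ne: "e1 \<noteq> h" "e2 \<noteq> h" using h by auto
  have "?s e1 < ?s h" "?s h < ?s e2"
    using le[OF K(2)] ne a_eqI[OF eI(1) h(1)] a_eqI[OF eI(2) h(1)] eI by (auto simp: le_less)
  then have z1: "q e2 $ 1 < z $ 1" "z $ 1 < q e1 $ 1"
    using left_of_witness[of h e1 z] right_of_witness[of h e2 z] eI h iso[OF e_iso(1)] iso[OF e_iso(2)]
    by auto
  define t where "t = (z $ 1 - q e2 $ 1) / (q e1 $ 1 - q e2 $ 1)"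
  have t: "0 \<le> t" "t \<le> 1" using z1 by (auto simp: t_def)
  define y where "y = (1 - t) *\<^sub>R q e2 + t *\<^sub>R q e1"
  have "y \<in> P"
    unfolding y_def using convex_P witness_in_P[OF eI(1)] witness_in_P[OF eI(2)] t
    by (simp add: convexD_alt)
  have "y $ 1 = q e2 $ 1 + t * (q e1 $ 1 - q e2 $ 1)" by (simp add: y_def algebra_simps)
  also have "\<dots> = z $ 1" using z1 by (simp add: t_def)
  finally have "g h z + g u z = g h y + g u y" using u(2) by (simp add: g_coords algebra_simps)
  then show ?thesis using P_nonneg[OF h(1) \<open>y \<in> P\<close>] P_nonneg[OF u(1) \<open>y \<in> P\<close>] h(3) by linarith
qed

lemma enumerate_by_key:
  obtains h where "bij_betw h {..<card I} I" "\<And>i j. \<lbrakk>i < j; j < card I\<rbrakk> \<Longrightarrow> key (h i) < key (h j)"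
proof -
  define ks where "ks = sorted_list_of_set (key ` I)"
  have len: "length ks = card I" by (simp add: ks_def card_image inj_key)
  have set_ks: "set ks = key ` I" using finite_I by (simp add: ks_def)
  define h where "h i = the_inv_into I key (ks ! i)" for i
  have nth: "ks ! i \<in> key ` I" if "i < card I" for i
    using that len set_ks nth_mem by metis
  have key_h: "key (h i) = ks ! i" if "i < card I" for i
    unfolding h_def using nth[OF that] inj_key by (rule f_the_inv_into_f[rotated])
  have h_I: "h i \<in> I" if "i < card I" for i
    unfolding h_def using inj_key nth[OF that] by (rule the_inv_into_into) simp
  have mono: "key (h i) < key (h j)" if "i < j" "j < card I" for i j
    using that key_h len strict_sorted_list_of_set[of "key ` I"]
    by (simp add: ks_def[symmetric] sorted_wrt_nth_less)
  have "inj_on h {..<card I}"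
    by (rule linorder_inj_onI) (use mono in fastforce)+
  moreover have "h ` {..<card I} \<subseteq> I" using h_I by auto
  ultimately have "bij_betw h {..<card I} I"
    using finite_I by (simp add: bij_betw_def card_image card_subset_eq)
  then show ?thesis using mono by (rule that)
qed

text \<open>A violated edge and a non-isolated edge with non-positive value lie in the same class,
  by \<open>opposite_not_violated\<close>, and \<open>violated_between\<close> fills the gap between
  them. So the violated positions have no holes, and a non-isolated edge vanishing at
  \<open>z\<close> is next to them.\<close>

lemma violated_interval:
  fixes m :: nat
  assumes h: "bij_betw h {..<m} I" "\<And>i j. \<lbrakk>i < j; j < m\<rbrakk> \<Longrightarrow> key (h i) < key (h j)"
    and z: "z \<notin> P" and iso: "\<And>i. i \<in> isolated \<Longrightarrow> 0 \<le> g i z"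
  obtains A B where "A \<le> B" "B < m" "\<And>j. j \<in> {A..B} \<Longrightarrow> g (h j) z < 0"
    "\<And>j. \<lbrakk>j < m; h j \<notin> isolated; g (h j) z \<le> 0\<rbrakk> \<Longrightarrow> A \<le> j + 1 \<and> j \<le> B + 1"
proof -
  have hI: "h j \<in> I" if "j < m" for j using h(1) that by (auto simp: bij_betw_def)
  define V where "V = {j. j < m \<and> g (h j) z < 0}"
  have "finite V" by (simp add: V_def)
  obtain i where "i \<in> I" "g i z < 0" using z by (auto simp: P_def not_le)
  then have "V \<noteq> {}" using h(1) by (force simp: V_def bij_betw_def)
  define A B where "A = Min V" and "B = Max V"
  have AB: "A \<in> V" "B \<in> V" "\<And>j. j \<in> V \<Longrightarrow> A \<le> j \<and> j \<le> B"
    using \<open>finite V\<close> \<open>V \<noteq> {}\<close> by (auto simp: A_def B_def)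
  have between: "j \<in> V"
    if i: "i \<in> V" and l: "l < m" "h l \<notin> isolated" "g (h l) z \<le> 0"
      and j: "i < j \<and> j < l \<or> l < j \<and> j < i" for i j l
  proof -
    have im: "i < m" "g (h i) z < 0" and jm: "j < m" using i l j by (auto simp: V_def)
    have i_iso: "h i \<notin> isolated" using iso[of "h i"] im by force
    then have nz: "a (h i) $ 2 \<noteq> 0" "a (h l) $ 2 \<noteq> 0"
      using l hI im by (auto simp: isolated_def)
    have "a (h l) $ 2 \<noteq> - a (h i) $ 2"
      using opposite_not_violated[OF hI[OF im(1)] i_iso im(2) hI[OF l(1)] _ iso] l(3) by force
    then have eq: "a (h i) $ 2 = a (h l) $ 2"
      using normalized[OF hI[OF im(1)]] normalized[OF hI[OF l(1)]] nz by auto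
    have "g (h j) z < 0"
      using j
    proof
      assume "i < j \<and> j < l"
      then show ?thesis
        using violated_between[of "h i" "h j" "h l" z] hI im jm l eq nz h(2) by simp
    next
      assume "l < j \<and> j < i"
      then show ?thesis
        using violated_between[of "h l" "h j" "h i" z] hI im jm l eq nz h(2) by simp
    qed
    then show ?thesis using jm by (simp add: V_def)
  qed
  have V_iso: "h j \<notin> isolated" if "j \<in> V" for j
    using that iso[of "h j"] by (force simp: V_def)
  show ?thesis
  proof (rule that)
    show "A \<le> B" "B < m" using AB by (auto simp: V_def)
    show "g (h j) z < 0" if "j \<in> {A..B}" for j
    proof -
      have "j \<in> V"
        using between[of A B j] AB(1,2) V_iso[OF AB(2)] that
        by (cases "j = A \<or> j = B") (auto simp: V_def)
      then show ?thesis by (simp add: V_def)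
    qed
    show "A \<le> j + 1 \<and> j \<le> B + 1" if j: "j < m" "h j \<notin> isolated" "g (h j) z \<le> 0" for j
    proof (rule ccontr)
      assume "\<not> ?thesis"
      then consider "j + 1 < A" | "B + 1 < j" by linarith
      then show False
      proof cases
        case 1
        \<comment> \<open>The position after \<open>j\<close> would be violated although it is
          smaller than the minimum \<open>A\<close>.\<close>
        then have "j + 1 \<in> V" using between[OF AB(1) j, of "j + 1"] by simp
        then show False using AB(3) 1 by fastforce
      next
        case 2
        then have "B + 1 \<in> V" using between[OF AB(2) j, of "B + 1"] by simp
        then show False using AB(3) by fastforce
      qed
    qed
  qed
qed

section \<open>Polynomials from a good word\<close>

lemma cond_C_prod:
  assumes E: "\<And>i. i \<in> {1..n} \<Longrightarrow> E i \<subseteq> I \<and> card (E i) \<le> k"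
  shows "cond_C k P n (\<lambda>i x. \<Prod>e\<in>E i. g e x)"
  unfolding cond_C_def
proof
  fix i assume i: "i \<in> {1..n}"
  have "finite (E i)" using E[OF i] finite_I finite_subset by blast
  then obtain f where f: "bij_betw f {1..card (E i)} (E i)"
    using ex_bij_betw_nat_finite_1 by blast
  have "(\<lambda>x. \<Prod>e\<in>E i. g e x) = (\<lambda>x. \<Prod>j=1..card (E i). g (f j) x)"
    by (intro ext prod.reindex_bij_betw[OF f, symmetric])
  moreover have "affine_function (g (f j)) \<and> (\<forall>x\<in>P. 0 \<le> g (f j) x) \<and>
      (\<exists>e\<in>edges P. \<forall>x\<in>e. g (f j) x = 0)" if "j \<in> {1..card (E i)}" for j
  proof -
    have "f j \<in> I" using f that E[OF i] by (auto simp: bij_betw_def)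
    moreover have "affine_function (g (f j))" unfolding affine_function_def g_def by blast
    ultimately show ?thesis by (auto simp: edges_P edge_def P_nonneg)
  qed
  ultimately show "\<exists>r\<le>k. \<exists>f. (\<lambda>x. \<Prod>e\<in>E i. g e x) = (\<lambda>x. \<Prod>j=1..r. f j x) \<and>
        (\<forall>j\<in>{1..r}. affine_function (f j) \<and> (\<forall>x\<in>P. 0 \<le> f j x) \<and>
                     (\<exists>e\<in>edges P. \<forall>x\<in>e. f j x = 0))"
    using E[OF i] by (intro exI[of _ "card (E i)"] exI[of _ "\<lambda>j. g (f j)"] conjI) auto
qed

text \<open>At a point outside \<open>P\<close> that satisfies the isolated inequalities, goodness
  applied to the violated interval yields a letter whose product has exactly one negative factor and
  otherwise positive ones.\<close>

lemma cond_Abar_C_of_good_word: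
  assumes w: "good w" "length w = card I" "set w \<subseteq> {..<n}" "\<And>x. count_list w x \<le> k" and "1 \<le> k"
  shows "\<exists>p. cond_Abar P (n + 6) p \<and> cond_C k P (n + 6) p"
proof -
  obtain h where h: "bij_betw h {..<card I} I"
      "\<And>i j. \<lbrakk>i < j; j < card I\<rbrakk> \<Longrightarrow> key (h i) < key (h j)"
    using enumerate_by_key by blast
  have hI: "h j \<in> I" if "j < card I" for j using h(1) that by (auto simp: bij_betw_def)
  have fin_iso: "finite isolated" using finite_I by (simp add: isolated_def)
  then obtain f where f: "bij_betw f {0..<card isolated} isolated"
    using ex_bij_betw_nat_finite by blast
  define T where "T x = {j. j < card I \<and> w ! j = x \<and> h j \<notin> isolated}" for x
  \<comment> \<open>Letter \<open>x\<close> belongs to polynomial \<open>x + 1\<close>, as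
    polynomials are numbered from 1. Isolated edges keep their place in the word but are left out of
    these products; each of the last six polynomials contains one of them or is the empty product
    1.\<close>
  define E where "E i = (if i \<le> n then h ` T (i - 1)
    else if i - n - 1 < card isolated then {f (i - n - 1)} else {})" for i
  have E: "E i \<subseteq> I \<and> card (E i) \<le> k" if "i \<in> {1..n + 6}" for i
  proof (cases "i \<le> n")
    case True
    have "card (E i) \<le> card (T (i - 1))"
      using True by (simp add: E_def T_def card_image_le)
    also have "\<dots> \<le> card {j. j < length w \<and> w ! j = i - 1}"
      by (intro card_mono) (auto simp: T_def w(2))
    also have "\<dots> = count_list w (i - 1)"
      unfolding count_list_eq_length_filter length_filter_conv_card
      by (rule arg_cong[where f = card]) auto
    finally show ?thesis using w(4)[of "i - 1"] True hI by (auto simp: E_def T_def)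
  next
    case False
    have "isolated \<subseteq> I" by (auto simp: isolated_def)
    then show ?thesis using False f \<open>1 \<le> k\<close> by (auto simp: E_def bij_betw_def)
  qed
  define p where "p i x = (\<Prod>e\<in>E i. g e x)" for i x
  have "cond_C k P (n + 6) p" unfolding p_def using E by (intro cond_C_prod) auto
  moreover have "P = {x. \<forall>i\<in>{1..n + 6}. 0 \<le> p i x}"
  proof
    show "P \<subseteq> {x. \<forall>i\<in>{1..n + 6}. 0 \<le> p i x}"
      unfolding p_def using E P_nonneg by (blast intro: prod_nonneg)
    show "{x. \<forall>i\<in>{1..n + 6}. 0 \<le> p i x} \<subseteq> P"
    proof (rule subsetI, rule ccontr)
      fix z assume z: "z \<in> {x. \<forall>i\<in>{1..n + 6}. 0 \<le> p i x}" "z \<notin> P"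
      have iso: "0 \<le> g i z" if i: "i \<in> isolated" for i
      proof -
        have "i \<in> f ` {0..<card isolated}" using f i by (simp add: bij_betw_def)
        then obtain t where t: "t < card isolated" "i = f t" by auto
        then have Et: "E (n + 1 + t) = {i}" by (simp add: E_def)
        have "n + 1 + t \<in> {1..n + 6}" using t card_isolated by simp
        then have "0 \<le> p (n + 1 + t) z" using z(1) by blast
        then show ?thesis unfolding p_def Et by simp
      qed
      obtain A B where AB: "A \<le> B" "B < card I" "\<And>j. j \<in> {A..B} \<Longrightarrow> g (h j) z < 0"
          "\<And>j. \<lbrakk>j < card I; h j \<notin> isolated; g (h j) z \<le> 0\<rbrakk> \<Longrightarrow> A \<le> j + 1 \<and> j \<le> B + 1"
        using violated_interval[OF h z(2) iso] by blast
      obtain j where j: "j \<in> {A..B}"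
          "\<forall>i<length w. w ! i = w ! j \<and> A \<le> i + 1 \<and> i \<le> B + 1 \<longrightarrow> i = j"
        using w(1,2) AB(1,2) unfolding good_def by metis
      have jm: "j < card I" "h j \<notin> isolated" using j(1) AB(2) AB(3)[OF j(1)] iso by force+
      let ?x = "w ! j"
      have x: "?x < n" using w(2,3) jm(1) nth_mem by force
      have Ex: "E (?x + 1) = h ` T ?x" using x by (simp add: E_def)
      have hj: "h j \<in> h ` T ?x" using jm by (simp add: T_def)
      \<comment> \<open>Any other position with this letter is outside the enlarged interval, so its
        non-isolated edge is strictly satisfied at \<open>z\<close>.\<close>
      have pos: "0 < g e z" if e: "e \<in> h ` T ?x - {h j}" for e
      proof (rule ccontr)
        assume "\<not> 0 < g e z"
        obtain i where i: "i \<in> T ?x" "e = h i" "i \<noteq> j" using e by blast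
        then have "A \<le> i + 1 \<and> i \<le> B + 1"
          using AB(4)[of i] \<open>\<not> 0 < g e z\<close> by (simp add: T_def)
        then show False using i j(2) w(2) by (simp add: T_def)
      qed
      have "p (?x + 1) z = g (h j) z * (\<Prod>e\<in>h ` T ?x - {h j}. g e z)"
        unfolding p_def Ex using hj by (intro prod.remove) (auto simp: T_def)
      also have "\<dots> < 0"
        using AB(3)[OF j(1)] pos by (intro mult_neg_pos prod_pos) auto
      finally have "p (?x + 1) z < 0" .
      moreover have "0 \<le> p (?x + 1) z" using z(1) x by simp
      ultimately show False by simp
    qed
  qed
  ultimately show ?thesis unfolding cond_Abar_def by blast
qed

end

lemma normalized_of_polygon:
  assumes "polygon Q"
  obtains I :: "(real^2) set set" and a b q
    where "normalized_halfplanes I a b q" "Q = irredundant_halfplanes.P I a b"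
proof -
  obtain I :: "(real^2) set set" and a b q
    where irr: "irredundant_halfplanes I a b q" and Q: "Q = irredundant_halfplanes.P I a b"
    by (rule irredundant_of_polygon[OF assms])
  interpret irredundant_halfplanes I a b q by fact
  define c where "c i = (if a i $ 2 = 0 then 1 / \<bar>a i $ 1\<bar> else 1 / \<bar>a i $ 2\<bar>)" for i
  have nz: "a i $ 1 \<noteq> 0 \<or> a i $ 2 \<noteq> 0" if "i \<in> I" for i
    using a_nonzero[OF that] by (auto simp: vec_eq_iff forall_2)
  have c: "0 < c i" if "i \<in> I" for i using nz[OF that] by (auto simp: c_def)
  have "normalized_halfplanes I (\<lambda>i. c i *\<^sub>R a i) (\<lambda>i. c i * b i) q"
    unfolding normalized_halfplanes_def normalized_halfplanes_axioms_def
    using irredundant_halfplanes_scale(1)[OF irr c] nz by (auto simp: c_def abs_if)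
  moreover have "Q = irredundant_halfplanes.P I (\<lambda>i. c i *\<^sub>R a i) (\<lambda>i. c i * b i)"
    using irredundant_halfplanes_scale(2)[OF irr c] Q by simp
  ultimately show ?thesis by (rule that)
qed

section \<open>Balanced good words\<close>

lemma sum_periodic:
  fixes h :: "nat \<Rightarrow> nat"
  assumes "\<And>i. h (i + c) = h i"
  shows "(\<Sum>i<Q * c. h i) = Q * (\<Sum>i<c. h i)"
proof (induction Q)
  case (Suc Q)
  then show ?case using sum_lessThan_add[of h c "Q * c"] assms by simp
qed simp

text \<open>The \<open>T\<close> blocks are padded to a power of two by empty ones, joined, and cut
  to length \<open>m\<close>. Since \<open>2 ^ L < 2 * T\<close>, each separator occurs fewer than
  \<open>T \<le> k\<close> times. At least \<open>T - 1\<close> separators are present, hence the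
  strict bound on \<open>m\<close>.\<close>

lemma word_of_blocks:
  assumes f: "\<And>i. set (f i) \<subseteq> {..<c}" "\<And>i. good (f i)" and T: "1 \<le> T" "T \<le> k"
    and count: "\<And>x. x < c \<Longrightarrow> (\<Sum>i<T. count_list (f i) x) \<le> k"
    and m: "m < (\<Sum>i<T. length (f i)) + T"
  obtains w L where "good w" "length w = m" "set w \<subseteq> {..<c + L}" "\<And>x. count_list w x \<le> k"
    "real L \<le> 1 + log 2 (real T)"
proof -
  obtain L where L: "T \<le> 2 ^ L" "2 ^ L < 2 * T"
  proof (cases "T = 1")
    case True
    then show ?thesis using that[of 0] by simp
  next
    case False
    then obtain l where "2 ^ l < T" "T \<le> 2 ^ (l + 1)" using T(1) ex_power_ivl2[of 2 T] by auto
    then show ?thesis using that[of "l + 1"] by simp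
  qed
  define f' where "f' i = (if i < T then f i else [])" for i
  have f': "set (f' i) \<subseteq> {..<c}" "good (f' i)" for i using f good_Nil by (auto simp: f'_def)
  have sum_f': "(\<Sum>i<2 ^ L. h (f' i)) = (\<Sum>i<T. h (f i))" if "h [] = 0" for h :: "nat list \<Rightarrow> nat"
  proof -
    have "(\<Sum>i<2 ^ L. h (f' i)) = (\<Sum>i<T. h (f' i))"
      by (rule sum.mono_neutral_right) (use L(1) that in \<open>auto simp: f'_def\<close>)
    then show ?thesis by (simp add: f'_def)
  qed
  define v where "v = join c L f'"
  have "length v + 1 = (\<Sum>i<T. length (f i)) + 2 ^ L"
    unfolding v_def length_join using sum_f'[of length] by simp
  then have len: "m \<le> length v" using m L(1) by linarith
  have count_v: "count_list v x \<le> k" for x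
  proof (cases "x < c")
    case True
    then show ?thesis
      using count[OF True] sum_f'[of "\<lambda>w. count_list w x"] by (simp add: v_def count_join_block)
  next
    case False
    then have "2 * count_list v x \<le> 2 ^ L"
      unfolding v_def using f' by (intro count_join_separator[of f' c]) auto
    then show ?thesis using L(2) T(2) by linarith
  qed
  have L_le: "real L \<le> 1 + log 2 (real T)"
  proof -
    have "(2::real) ^ L < 2 * real T"
      using L(2) by (metis of_nat_less_iff of_nat_mult of_nat_numeral of_nat_power)
    then have "log 2 (2 ^ L) \<le> log 2 (2 * real T)" using T(1) by (intro log_mono) auto
    then show ?thesis using T(1) by (simp add: log_nat_power log_mult)
  qed
  have count_take: "count_list (take m v) x \<le> k" for x
  proof -
    have "count_list v x = count_list (take m v) x + count_list (drop m v) x"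
      by (metis append_take_drop_id count_list_append)
    then show ?thesis using count_v[of x] by simp
  qed
  have "set v \<subseteq> {..<c + L}" unfolding v_def by (intro set_join f')
  then have "set (take m v) \<subseteq> {..<c + L}" using set_take_subset by (rule order_trans[rotated])
  moreover have "good (take m v)"
    unfolding v_def using f' by (intro good_take good_join_blocks)
  moreover have "length (take m v) = m" using len by simp
  ultimately show ?thesis using that count_take L_le by blast
qed

lemma s_ge_1: "2 \<le> m \<Longrightarrow> 1 \<le> s m k"
  unfolding s_def by (intro max.coboundedI2) simp

lemma log_le_add_log_sq:
  assumes "0 < T" "T \<le> 32 * x\<^sup>2" "1 \<le> (x::real)"
  shows "log 2 T \<le> 5 + 2 * log 2 x"
proof -
  have "log 2 T \<le> log 2 (2 ^ 5 * x\<^sup>2)" using assms by (intro log_mono) auto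
  also have "\<dots> = 5 + 2 * log 2 x"
    using assms(3) log_nat_power[of 2 2 5] by (simp add: log_mult log_nat_power del: power_numeral)
  finally show ?thesis .
qed

lemma count_list_distinct_le: "distinct w \<Longrightarrow> count_list w x \<le> 1"
  by (induction w) auto

text \<open>Each of \<open>k\<close> blocks uses \<open>m div k + 1\<close> distinct letters once.
  The roughly \<open>log 2 k\<close> separators are affordable because \<open>k\<close> is at most
  quadratic in \<open>s m k\<close>.\<close>

lemma good_word_small_k:
  assumes "2 \<le> m" "1 \<le> k" and small: "real k \<le> 24 * (s m k)\<^sup>2"
  shows "\<exists>n w. good w \<and> length w = m \<and> set w \<subseteq> {..<n} \<and> (\<forall>x. count_list w x \<le> k) \<and>
    real n \<le> s m k + 2 * log 2 (s m k) + 7"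
proof -
  define c where "c = m div k + 1"
  have c: "m < k * c" using assms(2) dividend_less_times_div[of k m] by (simp add: c_def)
  have c_le: "real c \<le> s m k + 1"
    using of_nat_div_le_of_nat[of m k, where ?'a = real] by (simp add: c_def s_def)
  obtain w L where w: "good w" "length w = m" "set w \<subseteq> {..<c + L}" "\<And>x. count_list w x \<le> k"
    "real L \<le> 1 + log 2 (real k)"
  proof (rule word_of_blocks[of "\<lambda>_. [0..<c]" c k k m])
    show "(\<Sum>i<k. count_list [0..<c] x) \<le> k" if "x < c" for x
      using count_list_distinct_le[of "[0..<c]" x] by simp
  qed (use c assms in \<open>auto intro: good_distinct\<close>)
  \<comment> \<open>Rounding 24 up to \<open>2 ^ 5\<close> gives the 5; with 1 from
    \<open>c_le\<close> and 1 from the bound on \<open>L\<close> this makes 7.\<close>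
  have "log 2 (real k) \<le> 5 + 2 * log 2 (s m k)"
    using assms s_ge_1[of m k] by (intro log_le_add_log_sq) auto
  then have "real (c + L) \<le> s m k + 2 * log 2 (s m k) + 7" using c_le w(5) by simp
  then show ?thesis using w(1-4) by blast
qed

lemma inj_on_rotation: "inj_on (\<lambda>l. (t + l) mod c) {..<c}" for c :: nat
proof (rule linorder_inj_onI)
  fix x y assume *: "x < y" "x \<in> {..<c}" "y \<in> {..<c}"
  have "\<not> c dvd (t + y) - (t + x)" using * by (auto dest: dvd_imp_le)
  moreover have "(t + y) mod c = (t + x) mod c \<longleftrightarrow> c dvd (t + y) - (t + x)"
    using *(1) by (intro mod_eq_dvd_iff_nat) simp
  ultimately show "(t + x) mod c \<noteq> (t + y) mod c" by simp
qed auto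

text \<open>For large \<open>k\<close>, joining \<open>k\<close> blocks costs too many separators.
  Ruler words of length \<open>2 ^ d - 1\<close>, with \<open>2 ^ d\<close> between
  \<open>k / (4 * s m k)\<close> and \<open>k / (2 * s m k)\<close>, reduce the number of blocks to
  a quadratic function of \<open>s m k\<close>; shifts modulo \<open>c\<close> balance their
  letters.\<close>

lemma good_word_large_k:
  assumes "2 \<le> m" "k \<le> m" and large: "24 * (s m k)\<^sup>2 \<le> real k"
  shows "\<exists>n w. good w \<and> length w = m \<and> set w \<subseteq> {..<n} \<and> (\<forall>x. count_list w x \<le> k) \<and>
    real n \<le> s m k + 2 * log 2 (s m k) + 7"
proof -
  define \<sigma> where "\<sigma> = s m k"
  have \<sigma>: "1 \<le> \<sigma>" "real m / real k \<le> \<sigma>" "log 2 (real m) \<le> \<sigma>"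
    using s_ge_1[OF assms(1), of k] by (auto simp: \<sigma>_def s_def)
  have \<sigma>2: "\<sigma> \<le> \<sigma>\<^sup>2" using \<sigma>(1) by (simp add: power2_eq_square)
  have large': "24 * \<sigma>\<^sup>2 \<le> real k" using large by (simp add: \<sigma>_def)
  then have k0: "0 < real k" using \<sigma>(1) \<sigma>2 by linarith
  define K where "K = nat \<lfloor>real k / (2 * \<sigma>)\<rfloor>"
  have "2 * \<sigma> \<le> real k" using large' \<sigma>2 \<sigma>(1) by linarith
  then have "1 \<le> real k / (2 * \<sigma>)" using \<sigma>(1) by simp
  then have K: "1 \<le> K" "real K \<le> real k / (2 * \<sigma>)" "real k / (2 * \<sigma>) < real K + 1"
    unfolding K_def by linarith+
  obtain d where d: "2 ^ d \<le> K" "K < 2 ^ (d + 1)" using ex_power_ivl1[of 2 K] K(1) by auto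
  have "real (2 ^ d) \<le> real K" using d(1) by (simp only: of_nat_le_iff)
  then have "2 ^ d \<le> real k / (2 * \<sigma>)"
    using K(2) unfolding of_nat_power of_nat_numeral by (rule order_trans)
  then have d_le: "2 ^ d * (2 * \<sigma>) \<le> real k" using \<sigma>(1) by (simp add: pos_le_divide_eq)
  have "real (K + 1) \<le> real (2 ^ (d + 1))"
    using d(2) by (simp only: of_nat_le_iff Suc_eq_plus1[symmetric] Suc_le_eq)
  then have "real k / (2 * \<sigma>) < 2 ^ d * 2"
    using K(3) unfolding of_nat_power of_nat_numeral of_nat_add of_nat_1 power_add by simp
  then have d_gt: "real k < (4 * \<sigma>) * 2 ^ d" using \<sigma>(1) by (simp add: pos_divide_less_eq mult_ac)
  \<comment> \<open>\<open>Q * c\<close> blocks: each of the \<open>c\<close> cyclic shifts of the ruler word is used \<open>Q\<close> times.\<close>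
  define Q where "Q = k div 2 ^ d"
  define X where "X = Q * 2 ^ d"
  have X: "X \<le> k" "k < X + 2 ^ d"
    using dividend_less_div_times[of "2 ^ d" k] by (simp_all add: X_def Q_def)
  have "real k < real (X + 2 ^ d)" using X(2) by (simp only: of_nat_less_iff)
  \<comment> \<open>Rounding \<open>k\<close> down to the multiple \<open>X\<close> of
    \<open>2 ^ d\<close> loses less than \<open>k / (2 * \<sigma>)\<close>, a fraction small enough
    for \<open>m / X\<close> to exceed \<open>\<sigma>\<close> by at most 1.\<close>
  then have "real k * (2 * \<sigma>) < (real X + 2 ^ d) * (2 * \<sigma>)" using \<sigma>(1) by simp
  then have X_gt: "real k * (2 * \<sigma> - 1) < real X * (2 * \<sigma>)"
    using d_le by (simp add: algebra_simps)
  have X0: "0 < X"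
  proof (rule ccontr)
    assume "\<not> 0 < X"
    then show False using X_gt k0 \<sigma>(1) by (simp add: mult_less_0_iff)
  qed
  then have "1 \<le> Q" by (simp add: X_def Suc_leI)
  have Q_le: "real Q \<le> 4 * \<sigma>"
  proof -
    have "real Q * 2 ^ d \<le> real k"
      using X(1) unfolding X_def by (metis of_nat_le_iff of_nat_mult of_nat_numeral of_nat_power)
    then have "real Q * 2 ^ d \<le> (4 * \<sigma>) * 2 ^ d" using d_gt by linarith
    then show ?thesis by simp
  qed
  \<comment> \<open>\<open>c\<close> exceeds \<open>m / X\<close>, so blocks and separators reach
    length \<open>m\<close>, and is at least \<open>d\<close>, so shifts modulo \<open>c\<close> are
    injective on the ruler letters.\<close>
  define c where "c = max d (m div X + 1)"
  have "1 \<le> c" "d \<le> c" by (auto simp: c_def)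
  have m_less: "m < X * c"
  proof -
    have "m < X * (m div X + 1)" using dividend_less_times_div[OF X0, of m] by simp
    also have "\<dots> \<le> X * c" unfolding c_def by (intro mult_le_mono2) simp
    finally show ?thesis .
  qed
  have c_le: "real c \<le> \<sigma> + 2"
  proof -
    have "(2::real) ^ d * 1 \<le> 2 ^ d * (2 * \<sigma>)" using \<sigma>(1) by (intro mult_left_mono) auto
    also have "\<dots> \<le> real m" using d_le assms(2) by simp
    finally have "log 2 (2 ^ d) \<le> log 2 (real m)" using assms(1) by (intro log_mono) auto
    then have "real d \<le> \<sigma>" using \<sigma>(3) by (simp add: log_nat_power)
    moreover have "real (m div X) \<le> \<sigma> + 1"
    proof -
      have "real m * (2 * \<sigma> - 1) \<le> \<sigma> * (real k * (2 * \<sigma> - 1))"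
        using \<sigma>(1,2) k0 by (simp add: pos_divide_le_eq mult.assoc[symmetric] mult_right_mono)
      also have "\<dots> \<le> \<sigma> * (real X * (2 * \<sigma>))"
        using X_gt \<sigma>(1) by (intro mult_left_mono) auto
      also have "\<dots> = real X * (2 * \<sigma>\<^sup>2)" by (simp add: power2_eq_square)
      \<comment> \<open>The two sides differ by \<open>X * (\<sigma> - 1)\<close>; afterwards the
        factor \<open>2 * \<sigma> - 1\<close> cancels.\<close>
      also have "\<dots> \<le> real X * ((\<sigma> + 1) * (2 * \<sigma> - 1))"
        using \<sigma>(1) by (intro mult_left_mono) (auto simp: power2_eq_square algebra_simps)
      finally have "real m \<le> real X * (\<sigma> + 1)"
        using \<sigma>(1) by (simp add: mult.assoc[symmetric])
      then have "real m / real X \<le> \<sigma> + 1" using X0 by (simp add: divide_le_eq mult.commute)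
      then show ?thesis using of_nat_div_le_of_nat[of m X, where ?'a = real] by linarith
    qed
    ultimately show ?thesis by (simp add: c_def)
  qed
  define T where "T = Q * c"
  have T_le: "real T \<le> 12 * \<sigma>\<^sup>2"
  proof -
    have "real T \<le> (4 * \<sigma>) * (\<sigma> + 2)"
      unfolding T_def of_nat_mult using Q_le c_le \<sigma>(1) by (intro mult_mono) auto
    also have "\<dots> \<le> 12 * \<sigma>\<^sup>2" using \<sigma>2 by (simp add: power2_eq_square algebra_simps)
    finally show ?thesis .
  qed
  have "real T \<le> real k" using T_le large' \<sigma>2 \<sigma>(1) by linarith
  then have "T \<le> k" by (simp only: of_nat_le_iff)
  moreover have "1 \<le> T" using \<open>1 \<le> Q\<close> \<open>1 \<le> c\<close> by (simp add: T_def Suc_le_eq)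
  ultimately have T: "1 \<le> T" "T \<le> k" by blast+
  define f where "f t = map (\<lambda>l. (t + l) mod c) (ruler d)" for t
  have f_set: "set (f t) \<subseteq> {..<c}" for t using \<open>1 \<le> c\<close> by (auto simp: f_def)
  have ruler_c: "set (ruler d) \<subseteq> {..<c}" using set_ruler[of d] \<open>d \<le> c\<close> by auto
  have f_good: "good (f t)" for t
    unfolding f_def using ruler_c by (intro good_map good_ruler inj_on_subset[OF inj_on_rotation])
  obtain w L where w: "good w" "length w = m" "set w \<subseteq> {..<c + L}" "\<And>x. count_list w x \<le> k"
    "real L \<le> 1 + log 2 (real T)"
  proof (rule word_of_blocks[OF f_set f_good T, where m = m])
    show "(\<Sum>i<T. count_list (f i) x) \<le> k" if "x < c" for x
    proof -
      have "f (t + c) = f t" for t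
        unfolding f_def by (rule map_cong[OF refl]) (metis add.assoc add.commute mod_add_self2)
      then have "(\<Sum>i<T. count_list (f i) x) = Q * (\<Sum>i<c. count_list (f i) x)"
        unfolding T_def by (intro sum_periodic) simp
      also have "\<dots> = Q * length (ruler d)"
        unfolding f_def using sum_count_rotations[OF ruler_c that] by simp
      also have "\<dots> \<le> X" unfolding X_def using length_ruler[of d] by (intro mult_le_mono2) simp
      finally show ?thesis using X(1) by simp
    qed
    have "(\<Sum>i<T. length (f i)) + T = T * (length (ruler d) + 1)" by (simp add: f_def)
    also have "\<dots> = X * c" unfolding length_ruler by (simp add: T_def X_def)
    finally show "m < (\<Sum>i<T. length (f i)) + T" using m_less by simp
  qed blast
  \<comment> \<open>Rounding 12 up to \<open>2 ^ 4\<close> gives the 4; with 2 from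
    \<open>c_le\<close> and 1 from the bound on \<open>L\<close> this again makes 7.\<close>
  have "log 2 (real T) \<le> log 2 (2 ^ 4 * \<sigma>\<^sup>2)" 
    using T_le T(1) \<sigma>(1) by (intro log_mono) auto
  also have "\<dots> = 4 + 2 * log 2 \<sigma>"
    using \<sigma>(1) log_nat_power[of 2 2 4] by (simp add: log_mult log_nat_power del: power_numeral)
  finally have "real (c + L) \<le> s m k + 2 * log 2 (s m k) + 7"
    using c_le w(5) by (simp add: \<sigma>_def)
  then show ?thesis using w(1-4) by blast
qed

text \<open>Values \<open>k > m\<close> are lowered to \<open>m\<close>, as
  \<open>good_word_large_k\<close> requires. This leaves \<open>s\<close> unchanged because then
  \<open>m / k \<le> 1 \<le> log 2 m\<close>.\<close>

lemma good_word_exists: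
  assumes "2 \<le> m" "1 \<le> k"
  shows "\<exists>n w. good w \<and> length w = m \<and> set w \<subseteq> {..<n} \<and> (\<forall>x. count_list w x \<le> k) \<and>
    real n \<le> s m k + 2 * log 2 (s m k) + 7"
proof -
  define k' where "k' = min k m"
  have "s m k' = s m k"
  proof (cases "k \<le> m")
    case False
    have "1 \<le> log 2 (real m)" using assms(1) by simp
    moreover have "real m / real k \<le> 1" "real m / real m = 1" using False assms(1) by simp_all
    ultimately have "s m m = log 2 (real m)" "s m k = log 2 (real m)"
      unfolding s_def by linarith+
    then show ?thesis using False by (simp add: k'_def)
  qed (simp add: k'_def)
  moreover have "\<exists>n w. good w \<and> length w = m \<and> set w \<subseteq> {..<n} \<and> (\<forall>x. count_list w x \<le> k') \<and>
      real n \<le> s m k' + 2 * log 2 (s m k') + 7"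
    using good_word_small_k[of m k'] good_word_large_k[of m k'] assms by (force simp: k'_def)
  moreover have "k' \<le> k" by (simp add: k'_def)
  ultimately show ?thesis by (metis le_trans)
qed

section \<open>The bounds for N and Nbar\<close>

definition works :: "((real^2) set \<Rightarrow> nat \<Rightarrow> (nat \<Rightarrow> real^2 \<Rightarrow> real) \<Rightarrow> bool) \<Rightarrow>
    nat \<Rightarrow> nat \<Rightarrow> nat \<Rightarrow> bool" where
  "works cond m k n \<longleftrightarrow> n \<ge> 1 \<and>
     (\<forall>P. polygon P \<and> card (edges P) = m \<longrightarrow>
        (\<exists>p. (\<forall>i\<in>{1..n}. real_polynomial_function (p i)) \<and> cond P n p \<and> cond_C k P n p))"

lemma N_Least: "N m k = (LEAST n. works cond_A m k n)"
  by (simp add: N_def works_def)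

lemma Nbar_Least: "Nbar m k = (LEAST n. works cond_Abar m k n)"
  by (simp add: Nbar_def works_def)

lemma works_Abar_of_good_word:
  assumes m: "1 \<le> m" and k: "1 \<le> k"
    and w: "good w" "length w = m" "set w \<subseteq> {..<n}" "\<And>x. count_list w x \<le> k"
  shows "works cond_Abar m k (n + 6)"
  unfolding works_def
proof (intro conjI allI impI)
  fix Q assume Q: "polygon Q \<and> card (edges Q) = m"
  obtain I :: "(real^2) set set" and a b q
    where norm: "normalized_halfplanes I a b q" and Q_eq: "Q = irredundant_halfplanes.P I a b"
    using normalized_of_polygon Q by blast
  interpret normalized_halfplanes I a b q by fact
  have "length w = card I" using Q w(2) by (simp add: Q_eq card_edges_P)
  then obtain p where "cond_Abar Q (n + 6) p" "cond_C k Q (n + 6) p"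
    using cond_Abar_C_of_good_word[OF w(1) _ w(3,4) k] unfolding Q_eq by blast
  then show "\<exists>p. (\<forall>i\<in>{1..n + 6}. real_polynomial_function (p i)) \<and>
      cond_Abar Q (n + 6) p \<and> cond_C k Q (n + 6) p"
    using real_polynomial_function_cond_C by blast
qed simp

text \<open>The word with \<open>m\<close> distinct letters shows that some number of polynomials
  works, so the minimum is attained.\<close>

lemma works_Nbar:
  assumes "1 \<le> m" "1 \<le> k"
  shows "works cond_Abar m k (Nbar m k)"
proof -
  have "count_list [0..<m] x \<le> k" for x
    using count_list_distinct_le[of "[0..<m]" x] assms(2) by simp
  then have "works cond_Abar m k (m + 6)"
    using assms by (intro works_Abar_of_good_word[of m k "[0..<m]"]) (auto intro: good_distinct)
  then show ?thesis unfolding Nbar_Least by (rule LeastI)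
qed

lemma works_A_of_works_Abar:
  assumes "1 \<le> m" "works cond_Abar m k n"
  shows "works cond_A m k n"
  unfolding works_def
proof (intro conjI allI impI)
  show "1 \<le> n" using assms(2) by (simp add: works_def)
  fix Q assume Q: "polygon Q \<and> card (edges Q) = m"
  obtain I :: "(real^2) set set" and a b q
    where irr: "irredundant_halfplanes I a b q" and Q_eq: "Q = irredundant_halfplanes.P I a b"
    using irredundant_of_polygon Q by blast
  interpret irredundant_halfplanes I a b q by fact
  have "I \<noteq> {}" using Q assms(1) card_edges_P Q_eq by auto
  moreover obtain p where "cond_Abar P n p" "cond_C k P n p"
    using assms(2) Q unfolding works_def Q_eq by blast
  ultimately obtain p' where "cond_A P n p'" "cond_C k P n p'"
    using cond_A_of_cond_Abar by blast
  then show "\<exists>p. (\<forall>i\<in>{1..n}. real_polynomial_function (p i)) \<and> cond_A Q n p \<and> cond_C k Q n p"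
    unfolding Q_eq using real_polynomial_function_cond_C by blast
qed

lemma lower_bound:
  assumes m: "1 \<le> m" and k: "1 \<le> k" and n: "works cond_A m k n"
  shows "s m k \<le> real n"
proof -
  \<comment> \<open>This one polygon yields both lower bounds.\<close>
  have "polygon (tangents.P m)" "card (edges (tangents.P m)) = m"
    using tangents.polygon_P[of m] tangents.card_edges_P[of m] by simp_all
  then obtain p where p: "cond_A (tangents.P m) n p" "cond_C k (tangents.P m) n p"
    using n unfolding works_def by blast
  have "m \<le> n * k" using tangents.card_le_of_cond_A_C[OF p] by simp
  then have "real m \<le> real n * real k" unfolding of_nat_mult[symmetric] of_nat_le_iff .
  then have "real m / real k \<le> real n" using k by (simp add: pos_divide_le_eq)
  moreover have "m \<le> 2 ^ n" using tangents_lower_bound[OF p] by simp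
  then have "real m \<le> 2 ^ n" by (metis of_nat_le_iff of_nat_numeral of_nat_power)
  then have "log 2 (real m) \<le> log 2 (2 ^ n)" using m by (intro log_mono) auto
  then have "log 2 (real m) \<le> real n" by (simp add: log_nat_power)
  ultimately show ?thesis by (simp add: s_def)
qed

text \<open>This turns the logarithmic error into a multiple of the square root of
  \<open>s m k\<close>, hence into a vanishing relative error.\<close>

lemma log_2_le_sqrt:
  assumes "1 \<le> (x::real)"
  shows "log 2 x \<le> 3 * sqrt x"
proof -
  have "ln x = 2 * ln (sqrt x)" using assms by (simp add: ln_sqrt)
  also have "\<dots> \<le> 2 * sqrt x"
    using ln_le_minus_one[of "sqrt x"] assms by simp
  also have "\<dots> \<le> 3 * sqrt x * ln 2"
    using mult_left_mono[OF ln2_ge_two_thirds, of "3 * sqrt x"] assms by simp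
  finally show ?thesis by (simp add: log_def pos_divide_le_eq)
qed

lemma upper_bound:
  assumes m: "2 \<le> m" and k: "1 \<le> k"
  shows "real (Nbar m k) \<le> (1 + 19 / sqrt (log 2 (real m))) * s m k"
proof -
  let ?s = "s m k"
  obtain n w where w: "good w" "length w = m" "set w \<subseteq> {..<n}" "\<And>x. count_list w x \<le> k"
    and n: "real n \<le> ?s + 2 * log 2 ?s + 7"
    using good_word_exists[OF m k] by blast
  have "works cond_Abar m k (n + 6)"
    using m k w by (intro works_Abar_of_good_word) auto
  then have "Nbar m k \<le> n + 6" unfolding Nbar_Least by (rule Least_le)
  \<comment> \<open>The 13 consists of 7 from the word and 6 for the isolated edges; as
    \<open>1 \<le> sqrt ?s\<close>, it adds to \<open>2 * 3\<close> from the logarithm to give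
    19.\<close>
  then have "real (Nbar m k) \<le> ?s + 2 * log 2 ?s + 13" using n by linarith
  also have "\<dots> \<le> ?s + 19 * sqrt ?s"
  proof -
    have "1 \<le> sqrt ?s" using s_ge_1[OF m, of k] by simp
    then show ?thesis using log_2_le_sqrt[OF s_ge_1[OF m, of k]] by linarith
  qed
  also have "\<dots> = (1 + 19 / sqrt ?s) * ?s"
    using s_ge_1[OF m, of k] by (simp add: field_simps)
  \<comment> \<open>Replacing \<open>?s\<close> by its lower bound \<open>log 2 m\<close> makes the
    error factor independent of \<open>k\<close>.\<close>
  also have "\<dots> \<le> (1 + 19 / sqrt (log 2 (real m))) * ?s"
  proof (intro mult_right_mono add_left_mono divide_left_mono)
    show "sqrt (log 2 (real m)) \<le> sqrt ?s" by (simp add: s_def)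
    show "0 < sqrt ?s * sqrt (log 2 (real m))" "0 \<le> ?s" using s_ge_1[OF m, of k] m by simp_all
  qed simp
  finally show ?thesis .
qed

text \<open>The upper bound is restricted to \<open>m \<ge> 2\<close>: as
  \<open>s 1 k = 1 / k\<close> and \<open>Nbar 1 k \<ge> 1\<close>, no value of \<epsilon> at 1
  could serve all \<open>k\<close>.\<close>

theorem theorem1p2:
  "\<exists>\<epsilon> :: nat \<Rightarrow> real. \<epsilon> \<longlonglongrightarrow> 0 \<and>
     (\<forall>m k. m \<ge> 1 \<and> k \<ge> 1 \<longrightarrow>
        s m k \<le> real (N m k) \<and> N m k \<le> Nbar m k \<and>
        (m \<ge> 2 \<longrightarrow> real (Nbar m k) \<le> (1 + \<epsilon> m) * s m k))"
proof (intro exI[of _ "\<lambda>m. 19 / sqrt (log 2 (real m))"] conjI allI impI)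
  show "(\<lambda>m. 19 / sqrt (log 2 (real m))) \<longlonglongrightarrow> 0" by real_asymp
  fix m k :: nat assume mk: "m \<ge> 1 \<and> k \<ge> 1"
  then have A: "works cond_A m k (Nbar m k)"
    using works_A_of_works_Abar works_Nbar by blast
  then show "N m k \<le> Nbar m k" unfolding N_Least by (rule Least_le)
  have "works cond_A m k (N m k)" using A unfolding N_Least by (rule LeastI)
  then show "s m k \<le> real (N m k)" using mk lower_bound by blast
  show "real (Nbar m k) \<le> (1 + 19 / sqrt (log 2 (real m))) * s m k" if "m \<ge> 2"
    using upper_bound that mk by blast
qed

end
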